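(* Let the data $X,K,X_j,\gamma_j,A,Y,\varphi,j,f,R,q,a_S$ satisfy the standing assumptions listed in the context, and assume $\alpha_\varphi+\alpha_jc_j^2<m_A$. Assume moreover that $q\in C^2(\mathbb R_+\times\mathbb R_+;\mathcal L(X))$ and that the solution $u\in C(\mathbb R_+;K)$ of the continuous problem stated in the context satisfies $u\in W^{2,\infty}_{loc}(\mathbb R_+;X)$. Fix $T>0$. For a positive integer $N$ and $k=T/N$ let $u^k=\{u_n^k\}_{n=0}^N\subset K$ satisfy, for every $0\le n\le N$ and every $v\in K$, $$\langle Au_n^k,v-u_n^k\rangle+\varphi(\mathcal S_{n,L}^ku^k,u_n^k,v)-\varphi(\mathcal S_{n,L}^ku^k,u_n^k,u_n^k)+j^0(\gamma_ju_n^k;\gamma_jv-\gamma_ju_n^k)\ge\langle f_n,v-u_n^k\rangle.$$ Then there is a constant $C_4>0$ independent of $k$ such that, with $u_n=u(t_n)$, $$\max_{n\le N}\|u_n-u_n^k\|_X\le C_4k^2.$$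
   Context: Notation. All spaces are real. $\mathbb R_+=[0,\infty)$; $X^*,X_j^*$ are topological duals; $\langle\cdot,\cdot\rangle$ is the duality pairing between $X^*$ and $X$, $\langle\cdot,\cdot\rangle_{X_j}$ the one between $X_j^*$ and $X_j$; $\mathcal L(\cdot;\cdot)$ denotes bounded linear operators, $\mathcal L(X)=\mathcal L(X;X)$. For a locally Lipschitz $j:X_j\to\mathbb R$, the Clarke directional derivative is $j^0(x;v)=\limsup_{y\to x,\lambda\downarrow0}\frac{j(y+\lambda v)-j(y)}{\lambda}$ and $\partial j(x)=\{\xi\in X_j^*: j^0(x;v)\ge\langle\xi,v\rangle_{X_j}\ \forall v\in X_j\}$. Standing assumptions on the data. $X$ is a reflexive Banach space, $K\subset X$ is closed and convex, $0\in K$. $X_j$ is a Banach space, $\gamma_j\in\mathcal L(X;X_j)$ and $c_j>0$ satisfies $\|\gamma_jv\|_{X_j}\le c_j\|v\|_X$ for all $v\in X$. $A:X\to X^*$ is Lipschitz continuous with constant $L_A>0$ and strongly monotone: $\langle Av_1-Av_2,v_1-v_2\rangle\ge m_A\|v_1-v_2\|_X^2$ for all $v_1,v_2\in X$, with $m_A>0$. $Y$ is a normed space and $\varphi:Y\times K\times K\to\mathbb R$ is such that $\varphi(y,u,\cdot)$ is convex and lower semicontinuous on $K$ for all $y\in Y,u\in K$, and there are $\alpha_\varphi>0,\beta_\varphi>0$ with $\varphi(y_1,u_1,v_2)-\varphi(y_1,u_1,v_1)+\varphi(y_2,u_2,v_1)-\varphi(y_2,u_2,v_2)\le\alpha_\varphi\|u_1-u_2\|_X\|v_1-v_2\|_X+\beta_\varphi\|y_1-y_2\|_Y\|v_1-v_2\|_X$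 for all $y_1,y_2\in Y$, $u_1,u_2,v_1,v_2\in K$. The function $j:X_j\to\mathbb R$ is locally Lipschitz; there are $c_0,c_1\ge0$ with $\|\xi\|_{X_j^*}\le c_0+c_1\|z\|_{X_j}$ for all $z\in X_j$, $\xi\in\partial j(z)$; there is $\alpha_j>0$ with $j^0(z_1;z_2-z_1)+j^0(z_2;z_1-z_2)\le\alpha_j\|z_1-z_2\|_{X_j}^2$ for all $z_1,z_2\in X_j$. $f\in C(\mathbb R_+;X^* )$. $R\in\mathcal L(X;Y)$, $q\in C(\mathbb R_+\times\mathbb R_+;\mathcal L(X))$, $a_S\in X$; these define the history-dependent operator $(\mathcal Sv)(t)=R\left(\int_0^tq(t,s)v(s)\,ds+a_S\right)$ for $v\in C(\mathbb R_+;X)$. Continuous problem. Find $u\in C(\mathbb R_+;K)$ such that for all $t\in\mathbb R_+$ and all $v\in K$, $\langle Au(t),v-u(t)\rangle+\varphi((\mathcal Su)(t),u(t),v)-\varphi((\mathcal Su)(t),u(t),u(t))+j^0(\gamma_ju(t);\gamma_jv-\gamma_ju(t))\ge\langle f(t),v-u(t)\rangle$. Time discretization. $t_n=nk$, $0\le n\le N$, $f_n=f(t_n)$. For a sequence $v=\{v_n\}$ in $X$ and $n\ge1$, $\mathcal S_{n,L}^kv=R\left(\frac k2q(t_n,t_0)v_0+k\sum_{i=1}^{n-1}q(t_n,t_i)v_i+\frac k2q(t_n,t_{n-1})v_{n-1}+a_S\right)$ (empty sum $=0$), and $\mathcal S_{0,L}^kv=R\,a_S$. *)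

theory Defs
  imports "HOL-Analysis.Analysis"
begin

definition reflexive_space :: "'a::real_normed_vector itself \<Rightarrow> bool" where
  "reflexive_space _ \<longleftrightarrow>
     (\<forall>F :: ('a \<Rightarrow>\<^sub>L real) \<Rightarrow>\<^sub>L real. \<exists>x. \<forall>\<xi>. blinfun_apply F \<xi> = blinfun_apply \<xi> x)"

definition lower_semicontinuous_on :: "'a::topological_space set \<Rightarrow> ('a \<Rightarrow> real) \<Rightarrow> bool" where
  "lower_semicontinuous_on S g \<longleftrightarrow>
     (\<forall>x\<in>S. \<forall>a<g x. \<forall>\<^sub>F y in at x within S. a < g y)"

definition locally_lipschitz :: "('a::metric_space \<Rightarrow> 'b::metric_space) \<Rightarrow> bool" where
  "locally_lipschitz g \<longleftrightarrow> (\<forall>x. \<exists>r>0. \<exists>L. L-lipschitz_on (ball x r) g)"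

text \<open>The base point is allowed to equal \<open>x\<close> (hence \<open>nhds x\<close>), and the limsup is
  finite whenever \<open>g\<close> is locally Lipschitz, so that the conversion to \<open>real\<close> loses nothing.\<close>

definition clarke_deriv :: "('a::real_normed_vector \<Rightarrow> real) \<Rightarrow> 'a \<Rightarrow> 'a \<Rightarrow> real" where
  "clarke_deriv g x v = real_of_ereal
     (Limsup (nhds x \<times>\<^sub>F at_right 0) (\<lambda>(y, l). ereal ((g (y + l *\<^sub>R v) - g y) / l)))"

definition clarke_subdiff :: "('a::real_normed_vector \<Rightarrow> real) \<Rightarrow> 'a \<Rightarrow> ('a \<Rightarrow>\<^sub>L real) set" where
  "clarke_subdiff g x = {\<xi>. \<forall>v. clarke_deriv g x v \<ge> blinfun_apply \<xi> v}"

text \<open>Class \<open>C\<^sup>2\<close> on a possibly non-open set \<open>S\<close>, with derivatives relative to \<open>S\<close>; on a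
  closed quadrant these are one-sided at the boundary and uniquely determined.\<close>

definition C2_on :: "'a::real_normed_vector set \<Rightarrow> ('a \<Rightarrow> 'b::real_normed_vector) \<Rightarrow> bool" where
  "C2_on S g \<longleftrightarrow>
     (\<exists>(D :: 'a \<Rightarrow> 'a \<Rightarrow>\<^sub>L 'b) (D2 :: 'a \<Rightarrow> 'a \<Rightarrow>\<^sub>L 'a \<Rightarrow>\<^sub>L 'b).
        (\<forall>p\<in>S. (g has_derivative blinfun_apply (D p)) (at p within S)) \<and>
        (\<forall>p\<in>S. (D has_derivative blinfun_apply (D2 p)) (at p within S)) \<and>
        continuous_on S D2)"

text \<open>Vector-valued Lebesgue and Sobolev spaces on \<open>(0, T)\<close>. The Banach space is not assumed
  separable, which rules out \<open>borel_measurable\<close> and the library's Bochner integral. Strong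
  measurability is therefore spelled out through simple functions, and integrals are taken in the
  Henstock--Kurzweil sense, which agrees with the Bochner integral on Bochner integrable
  functions.\<close>

definition strongly_measurable :: "'t measure \<Rightarrow> ('t \<Rightarrow> 'a::topological_space) \<Rightarrow> bool" where
  "strongly_measurable M g \<longleftrightarrow>
     (\<exists>s :: nat \<Rightarrow> 't \<Rightarrow> 'a. (\<forall>i. simple_function M (s i)) \<and>
        (AE t in M. (\<lambda>i. s i t) \<longlonglongrightarrow> g t))"

definition Linf :: "real \<Rightarrow> (real \<Rightarrow> 'a::real_normed_vector) set" where
  "Linf T = {g. strongly_measurable (lebesgue_on {0<..<T}) g \<and>
                (\<exists>B. AE t in lebesgue_on {0<..<T}. norm (g t) \<le> B)}"

definition test_functions :: "real \<Rightarrow> (real \<Rightarrow> real) set" where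
  "test_functions T =
     {\<psi>. (\<forall>n t. (deriv ^^ n) \<psi> field_differentiable at t) \<and>
         closure {t. \<psi> t \<noteq> 0} \<subseteq> {0<..<T}}"

definition weak_derivative ::
    "real \<Rightarrow> nat \<Rightarrow> (real \<Rightarrow> 'a::real_normed_vector) \<Rightarrow> (real \<Rightarrow> 'a) \<Rightarrow> bool" where
  "weak_derivative T n u g \<longleftrightarrow>
     (\<forall>\<psi>\<in>test_functions T. \<exists>I.
        ((\<lambda>t. (deriv ^^ n) \<psi> t *\<^sub>R u t) has_integral I) {0..T} \<and>
        ((\<lambda>t. \<psi> t *\<^sub>R g t) has_integral ((-1) ^ n *\<^sub>R I)) {0..T})"

definition Sobolev_inf :: "nat \<Rightarrow> real \<Rightarrow> (real \<Rightarrow> 'a::real_normed_vector) set" where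
  "Sobolev_inf m T =
     {u \<in> Linf T. \<forall>n\<in>{1..m}. \<exists>g\<in>Linf T. weak_derivative T n u g}"

definition Sobolev_inf_loc :: "nat \<Rightarrow> (real \<Rightarrow> 'a::real_normed_vector) set" where
  "Sobolev_inf_loc m = (\<Inter>T\<in>{0<..}. Sobolev_inf m T)"

definition history_op ::
    "('a::banach \<Rightarrow>\<^sub>L 'c::real_normed_vector) \<Rightarrow> (real \<times> real \<Rightarrow> 'a \<Rightarrow>\<^sub>L 'a) \<Rightarrow> 'a
     \<Rightarrow> (real \<Rightarrow> 'a) \<Rightarrow> real \<Rightarrow> 'c" where
  "history_op R q a v t =
     blinfun_apply R (integral {0..t} (\<lambda>s. blinfun_apply (q (t, s)) (v s)) + a)"

definition history_op_disc ::
    "('a::banach \<Rightarrow>\<^sub>L 'c::real_normed_vector) \<Rightarrow> (real \<times> real \<Rightarrow> 'a \<Rightarrow>\<^sub>L 'a) \<Rightarrow> 'a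
     \<Rightarrow> real \<Rightarrow> (nat \<Rightarrow> 'a) \<Rightarrow> nat \<Rightarrow> 'c" where
  "history_op_disc R q a k v n =
     (if n = 0 then blinfun_apply R a
      else blinfun_apply R
        ((k / 2) *\<^sub>R blinfun_apply (q (real n * k, 0)) (v 0)
         + k *\<^sub>R (\<Sum>i=1..n-1. blinfun_apply (q (real n * k, real i * k)) (v i))
         + (k / 2) *\<^sub>R blinfun_apply (q (real n * k, real (n - 1) * k)) (v (n - 1))
         + a))"

text \<open>The inequality satisfied at a single time: \<open>y\<close> is the value of the history term, \<open>f\<close> the
  load and \<open>w\<close> the unknown.\<close>

definition solves_vhi ::
    "'a::real_normed_vector set \<Rightarrow> ('a \<Rightarrow> 'a \<Rightarrow>\<^sub>L real) \<Rightarrow> ('c \<Rightarrow> 'a \<Rightarrow> 'a \<Rightarrow> real)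
     \<Rightarrow> ('b::real_normed_vector \<Rightarrow> real) \<Rightarrow> ('a \<Rightarrow>\<^sub>L 'b) \<Rightarrow> 'c \<Rightarrow> ('a \<Rightarrow>\<^sub>L real) \<Rightarrow> 'a \<Rightarrow> bool" where
  "solves_vhi K A \<phi> j \<gamma> y f w \<longleftrightarrow>
     w \<in> K \<and>
     (\<forall>v\<in>K. blinfun_apply (A w) (v - w) + \<phi> y w v - \<phi> y w w
             + clarke_deriv j (blinfun_apply \<gamma> w) (blinfun_apply \<gamma> v - blinfun_apply \<gamma> w)
            \<ge> blinfun_apply f (v - w))"

definition continuous_solution where
  "continuous_solution K A \<phi> j \<gamma> f R q a u \<longleftrightarrow>
     continuous_on {0..} u \<and>
     (\<forall>t\<ge>0. solves_vhi K A \<phi> j \<gamma> (history_op R q a u t) (f t) (u t))"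

definition discrete_solution where
  "discrete_solution K A \<phi> j \<gamma> f R q a k N w \<longleftrightarrow>
     (\<forall>n\<le>N. solves_vhi K A \<phi> j \<gamma> (history_op_disc R q a k w n) (f (real n * k)) (w n))"

end

theory Submission
  imports Defs
begin

text \<open>
  Two solutions of the variational-hemivariational inequality at the same time, with the same load
  but different history terms, can be tested against each other. Strong monotonicity beats the
  constants of \<open>\<phi>\<close> and \<open>j\<close> by the smallness condition, so the distance of the solutions is at most a
  constant times the distance of the history terms (\<open>solves_vhi_stability\<close>). The history term of the
  exact solution and that of the discrete one differ by a quadrature error, committed on the exact
  solution, plus \<open>O(k)\<close> times the sum of the earlier errors. The discrete Gronwall inequality
  therefore reduces the claim to a quadrature error of order \<open>k\<^sup>2\<close>.

  The quadrature rule is the trapezoidal rule, except that the last node value is replaced by the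
  one before it. On a single step of length \<open>k\<close> this replacement costs \<open>k / 2\<close> times an increment of
  the integrand, which is \<open>O(k\<^sup>2)\<close> for a Lipschitz integrand. The trapezoidal rule itself needs no
  derivatives: an error \<open>O(k\<^sup>3)\<close> on each step follows from a bound \<open>M * h\<^sup>2\<close> on the second differences of the
  integrand (\<open>trapezoid_error\<close>). So the natural notion of regularity here is \<open>C11_bound\<close>: a bound on
  values, first differences and second differences. It is preserved by applying an operator-valued
  function to a vector-valued one, a \<open>C\<^sup>2\<close> kernel has it by the mean value inequality, and what remains
  is to get it for the solution.

  The solution is continuous and has bounded weak derivatives of orders 1 and 2. Let \<open>\<rho>\<close> be a
  mollifier, \<open>P\<close> its primitive and \<open>Q\<close> the primitive of \<open>P\<close>. The test function
  \<open>P (s - a) - P (s - a - h)\<close> has as derivative a difference of two mollifiers, and the second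
  difference of \<open>Q\<close> has as second derivative a second difference of mollifiers. Paired with \<open>u\<close> they
  yield, in the limit of vanishing width, the first and second differences of \<open>u\<close>; paired with the
  weak derivatives they are bounded by the mass of the test function, which is of order \<open>h\<close>
  and \<open>h\<^sup>2\<close>. This gives the pointwise bounds without representing \<open>u\<close> as the integral of its weak
  derivative.
\<close>

section \<open>Smooth step functions\<close>

text \<open>The recursion peels off the first derivative, so that the product rule
  closes an induction on the order without Leibniz's formula.\<close>

primrec times_differentiable :: "nat \<Rightarrow> (real \<Rightarrow> real) \<Rightarrow> bool" where
  "times_differentiable 0 g \<longleftrightarrow> True"
| "times_differentiable (Suc n) g \<longleftrightarrow>
     (\<exists>g'. (\<forall>t. (g has_real_derivative g' t) (at t)) \<and> times_differentiable n g')"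

lemma times_differentiable_SucI:
  assumes "\<And>t. (g has_real_derivative g' t) (at t)" "times_differentiable n g'"
  shows "times_differentiable (Suc n) g"
  using assms by auto

lemma times_differentiable_Suc_imp:
  "times_differentiable (Suc n) g \<Longrightarrow> times_differentiable n g"
proof (induction n arbitrary: g)
  case (Suc n)
  then obtain g' where "\<And>t. (g has_real_derivative g' t) (at t)" "times_differentiable (Suc n) g'"
    unfolding times_differentiable.simps(2)[of "Suc n" g] by blast
  then show ?case using Suc.IH by (blast intro: times_differentiable_SucI)
qed simp

lemma times_differentiable_add:
  "times_differentiable n f \<Longrightarrow> times_differentiable n g \<Longrightarrow> times_differentiable n (\<lambda>t. f t + g t)"
proof (induction n arbitrary: f g)
  case (Suc n)
  then obtain f' g' where
    "\<And>t. (f has_real_derivative f' t) (at t)" "times_differentiable n f'"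
    "\<And>t. (g has_real_derivative g' t) (at t)" "times_differentiable n g'" by auto
  then show ?case
    by (intro times_differentiable_SucI[of _ "\<lambda>t. f' t + g' t"] DERIV_add Suc.IH)
qed simp

lemma times_differentiable_mult:
  "times_differentiable n f \<Longrightarrow> times_differentiable n g \<Longrightarrow> times_differentiable n (\<lambda>t. f t * g t)"
proof (induction n arbitrary: f g)
  case (Suc n)
  then obtain f' g' where
    d: "\<And>t. (f has_real_derivative f' t) (at t)" "times_differentiable n f'"
    "\<And>t. (g has_real_derivative g' t) (at t)" "times_differentiable n g'" by auto
  note lower = Suc.prems[THEN times_differentiable_Suc_imp]
  show ?case
    by (rule times_differentiable_SucI[of _ "\<lambda>t. f' t * g t + g' t * f t"])
      (rule DERIV_mult[OF d(1) d(3)]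
        times_differentiable_add[OF Suc.IH[OF d(2) lower(2)] Suc.IH[OF d(4) lower(1)]])+
qed simp

lemma times_differentiable_const: "times_differentiable n (\<lambda>t. c)"
  by (induction n arbitrary: c) (simp, rule times_differentiable_SucI, rule DERIV_const, assumption)

lemma times_differentiable_affine_compose:
  "times_differentiable n g \<Longrightarrow> times_differentiable n (\<lambda>t. g (a * t + b))"
proof (induction n arbitrary: g)
  case (Suc n)
  then obtain g' where d: "\<And>t. (g has_real_derivative g' t) (at t)" "times_differentiable n g'"
    by auto
  define h where "h t = g' (a * t + b) * a" for t
  have inner: "((\<lambda>t. a * t + b) has_real_derivative a) (at t)" for t
    by (auto intro!: derivative_eq_intros)
  have "((\<lambda>t. g (a * t + b)) has_real_derivative h t) (at t)" for t
    unfolding h_def by (rule DERIV_chain2[OF d(1) inner])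
  moreover have "times_differentiable n h"
    unfolding h_def[abs_def]
    by (rule times_differentiable_mult[OF Suc.IH[OF d(2)] times_differentiable_const])
  ultimately show ?case
    by (rule times_differentiable_SucI)
qed simp

lemma times_differentiable_imp_higher_deriv:
  "times_differentiable (Suc n) g \<Longrightarrow> (deriv ^^ n) g field_differentiable at t"
proof (induction n arbitrary: g)
  case 0
  then show ?case by (auto simp: field_differentiable_def)
next
  case (Suc n)
  then obtain g' where d: "\<And>t. (g has_real_derivative g' t) (at t)" "times_differentiable (Suc n) g'"
    unfolding times_differentiable.simps(2)[of "Suc n" g] by blast
  have "deriv g = g'" using d(1) by (auto intro!: ext DERIV_imp_deriv)
  then show ?case using Suc.IH[OF d(2)] by (simp add: funpow_swap1)
qed

text \<open>The functions \<open>p (1 / x) * exp (- 1 / x)\<close>, extended by zero to the left, are closed under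
  differentiation: the derivative belongs to the polynomial \<open>X\<^sup>2 * (p - p')\<close>. At the origin the
  difference quotient vanishes because exponentials dominate polynomials.\<close>

lemma times_differentiable_exp_inverse:
  "times_differentiable n (\<lambda>x. if x > 0 then poly p (1 / x) * exp (- 1 / x) else 0)"
proof (induction n arbitrary: p)
  case (Suc n)
  define f where "f p x = (if x > 0 then poly p (1 / x) * exp (- 1 / x) else 0)" for p :: "real poly" and x :: real
  define p' where "p' = monom 1 2 * (p - pderiv p)"
  have "(f p has_real_derivative f p' x) (at x)" for x
  proof -
    consider "x > 0" | "x < 0" | "x = 0" by linarith
    then show ?thesis
    proof cases
      case 1
      have "((\<lambda>x. poly p (1 / x) * exp (- 1 / x)) has_real_derivative
              poly p' (1 / x) * exp (- 1 / x)) (at x)"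
        using 1 unfolding p'_def
        by (auto intro!: derivative_eq_intros DERIV_chain2[OF poly_DERIV]
            simp: poly_monom field_simps power2_eq_square)
      then have "(f p has_real_derivative poly p' (1 / x) * exp (- 1 / x)) (at x)"
        by (rule DERIV_cong_ev[THEN iffD1, rotated -1])
           (use 1 in \<open>auto simp: f_def intro!: eventually_mono[OF eventually_nhds_in_open[of "{0<..}"]]\<close>)
      then show ?thesis using 1 by (simp add: f_def)
    next
      case 2
      have "((\<lambda>x. 0::real) has_real_derivative 0) (at x)" by simp
      then have "(f p has_real_derivative 0) (at x)"
        by (rule DERIV_cong_ev[THEN iffD1, rotated -1])
           (use 2 in \<open>auto simp: f_def intro!: eventually_mono[OF eventually_nhds_in_open[of "{..<0}"]]\<close>)
      then show ?thesis using 2 by (simp add: f_def)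
    next
      case 3
      \<comment> \<open>Dividing by \<open>h\<close> multiplies the polynomial in \<open>1 / h\<close> by its variable, whence \<open>pCons 0 p\<close>.\<close>
      have lim: "((\<lambda>y. poly (pCons 0 p) y / exp y) \<longlongrightarrow> 0) at_top"
      proof -
        have "((\<lambda>y. \<Sum>i\<le>degree (pCons 0 p). coeff (pCons 0 p) i * (y ^ i / exp y)) \<longlongrightarrow> 
             (\<Sum>i\<le>degree (pCons 0 p). coeff (pCons 0 p) i * 0)) (at_top :: real filter)"
          by (intro tendsto_sum tendsto_mult tendsto_const tendsto_power_div_exp_0)
        then show ?thesis by (simp add: poly_altdef sum_divide_distrib)
      qed
      have "((\<lambda>x. poly (pCons 0 p) (1 / x) / exp (1 / x)) \<longlongrightarrow> 0) (at_right (0::real))"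
        using filterlim_compose[OF lim filterlim_inverse_at_top_right] by (simp add: inverse_eq_divide)
      then have R: "((\<lambda>h. (f p (0 + h) - f p 0) / h) \<longlongrightarrow> 0) (at_right 0)"
        by (rule Lim_transform_eventually)
          (auto intro!: eventually_at_right_less[THEN eventually_mono] simp: f_def exp_minus field_simps)
      have L: "((\<lambda>h. (f p (0 + h) - f p 0) / h) \<longlongrightarrow> 0) (at_left 0)"
        by (rule Lim_transform_eventually[OF tendsto_const])
          (auto intro!: eventually_at_leftI[of "-1"] simp: f_def)
      show ?thesis using filterlim_split_at[OF L R] 3 by (simp add: DERIV_def f_def)
    qed
  qed
  moreover have "times_differentiable n (f p')"
    using Suc.IH[of p'] by (simp add: f_def[abs_def])
  ultimately have "times_differentiable (Suc n) (f p)" by auto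
  then show ?case by (simp add: f_def[abs_def])
qed simp

text \<open>An integral over \<open>{0..x}\<close> with \<open>x < 0\<close> is zero. For an integrand that vanishes
  to the left of \<open>\<epsilon> > 0\<close> this is the correct value of the primitive, so one formula serves the whole
  real line.\<close>

lemma integral_has_derivative_of_right_supported:
  fixes g :: "real \<Rightarrow> real"
  assumes "continuous_on UNIV g" "\<epsilon> > 0" and zero: "\<And>x. x \<le> \<epsilon> \<Longrightarrow> g x = 0"
  shows "((\<lambda>x. integral {0..x} g) has_real_derivative g x) (at x)"
    and "x \<le> \<epsilon> \<Longrightarrow> integral {0..x} g = 0"
proof -
  have vanish: "integral {0..x} g = 0" if "x \<le> \<epsilon>" for x
  proof -
    have "integral {0..x} g = integral {0..x} (\<lambda>_. 0)"
      by (rule integral_cong) (use that zero in auto)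
    then show ?thesis by simp
  qed
  then show "x \<le> \<epsilon> \<Longrightarrow> integral {0..x} g = 0" .
  show "((\<lambda>x. integral {0..x} g) has_real_derivative g x) (at x)"
  proof (cases "x < \<epsilon>")
    case True
    have "((\<lambda>x. 0::real) has_real_derivative 0) (at x)" by simp
    then have "((\<lambda>x. integral {0..x} g) has_real_derivative 0) (at x)"
      by (rule DERIV_cong_ev[THEN iffD1, rotated -1])
         (use True in \<open>auto simp: vanish intro!: eventually_mono[OF eventually_nhds_in_open[of "{..<\<epsilon>}"]]\<close>)
    then show ?thesis using True zero by simp
  next
    case False
    then have x: "x \<in> interior {0..x + 1}" using \<open>\<epsilon> > 0\<close> by simp
    have "((\<lambda>x. integral {0..x} g) has_real_derivative g x) (at x within {0..x + 1})"
      by (rule integral_has_real_derivative)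
        (use x interior_subset assms(1) continuous_on_subset in blast)+
    then show ?thesis using at_within_interior[OF x] by simp
  qed
qed

text \<open>A mollifier \<open>\<rho>\<close> with its first two primitives, a step \<open>P\<close> and a ramp \<open>Q\<close>. The
  mollifier lives strictly to the right of the origin: its translate to \<open>a\<close> then stays
  inside an interval \<open>{0<..<T}\<close> even for \<open>a = 0\<close>, and boundary points need no separate treatment.\<close>

locale smooth_step =
  fixes \<epsilon> :: real and \<rho> P Q :: "real \<Rightarrow> real"
  assumes width_pos: "0 < \<epsilon>"
    and step_deriv: "(P has_real_derivative \<rho> x) (at x)"
    and bump_cont: "continuous_on UNIV \<rho>"
    and bump_nonneg: "0 \<le> \<rho> x"
    and bump_supp: "x \<notin> {\<epsilon><..<2 * \<epsilon>} \<Longrightarrow> \<rho> x = 0"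
    and step_left: "x \<le> \<epsilon> \<Longrightarrow> P x = 0"
    and step_right: "2 * \<epsilon> \<le> x \<Longrightarrow> P x = 1"
    and step_nonneg: "0 \<le> P x"
    and step_le_1: "P x \<le> 1"
    and ramp_deriv: "(Q has_real_derivative P x) (at x)"
    and ramp_left: "x \<le> \<epsilon> \<Longrightarrow> Q x = 0"
    and ramp_right: "2 * \<epsilon> \<le> x \<Longrightarrow> Q x = Q (2 * \<epsilon>) + (x - 2 * \<epsilon>)"
    and step_smooth: "times_differentiable n P"
    and ramp_smooth: "times_differentiable n Q"

lemma smooth_step_exists:
  assumes "0 < \<epsilon>"
  obtains \<rho> P Q where "smooth_step \<epsilon> \<rho> P Q"
proof -
  define b :: "real \<Rightarrow> real" where "b x = (if x > 0 then exp (- 1 / x) else 0)" for x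
  \<comment> \<open>The affine arguments have the form that closure under affine substitution expects.\<close>
  define \<beta> where "\<beta> x = b (1 * x + - \<epsilon>) * b (- 1 * x + 2 * \<epsilon>)" for x
  have smooth_b: "times_differentiable n b" for n
    using times_differentiable_exp_inverse[of n 1] by (simp add: b_def[abs_def] cong: if_cong)
  have smooth_\<beta>: "times_differentiable n \<beta>" for n
    unfolding \<beta>_def[abs_def]
    by (rule times_differentiable_mult[OF times_differentiable_affine_compose[OF smooth_b]
          times_differentiable_affine_compose[OF smooth_b]])
  have \<beta>_nonneg: "0 \<le> \<beta> x" for x by (simp add: \<beta>_def b_def)
  have \<beta>_pos: "0 < \<beta> x" if "\<epsilon> < x" "x < 2 * \<epsilon>" for x using that by (simp add: \<beta>_def b_def)
  have \<beta>_zero: "\<beta> x = 0" if "x \<notin> {\<epsilon><..<2 * \<epsilon>}" for x using that by (auto simp: \<beta>_def b_def)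
  have cont: "continuous_on UNIV g" if "times_differentiable 1 g" for g
    using that by (auto intro: DERIV_continuous_on)
  define P0 where "P0 x = integral {0..x} \<beta>" for x
  have P0: "(P0 has_real_derivative \<beta> x) (at x)" "x \<le> \<epsilon> \<Longrightarrow> P0 x = 0" for x
    unfolding P0_def[abs_def]
    by (rule integral_has_derivative_of_right_supported[OF cont[OF smooth_\<beta>] assms]; simp add: \<beta>_zero)+
  define c where "c = P0 (2 * \<epsilon>)"
  have "c > 0"
  proof -
    obtain z where "\<epsilon> < z" "z < 2 * \<epsilon>" "P0 (2 * \<epsilon>) - P0 \<epsilon> = (2 * \<epsilon> - \<epsilon>) * \<beta> z"
      using MVT2[of \<epsilon> "2 * \<epsilon>" P0 \<beta>] P0(1) assms by auto
    then show ?thesis using assms \<beta>_pos[of z] P0(2)[of \<epsilon>] by (simp add: c_def)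
  qed
  define \<rho> where "\<rho> x = (1 / c) * \<beta> x" for x
  define P where "P x = (1 / c) * P0 x" for x
  have P: "(P has_real_derivative \<rho> x) (at x)" for x
    unfolding P_def[abs_def] \<rho>_def by (intro DERIV_cmult P0)
  have smooth_P: "times_differentiable n P" for n
    unfolding P_def[abs_def]
  proof (rule times_differentiable_mult[OF times_differentiable_const])
    show "times_differentiable n P0"
      using P0(1) smooth_\<beta> by (cases n) (simp, auto intro: times_differentiable_SucI)
  qed
  have \<rho>_nonneg: "0 \<le> \<rho> x" for x using \<beta>_nonneg \<open>c > 0\<close> by (simp add: \<rho>_def)
  have cont_\<rho>: "continuous_on UNIV \<rho>"
    unfolding \<rho>_def[abs_def] by (intro continuous_intros cont smooth_\<beta>)
  have \<rho>_zero: "\<rho> x = 0" if "x \<notin> {\<epsilon><..<2 * \<epsilon>}" for x using \<beta>_zero[OF that] by (simp add: \<rho>_def)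
  have P_mono: "P x \<le> P y" if "x \<le> y" for x y
    by (rule DERIV_nonneg_imp_nondecreasing[OF that]) (use P \<rho>_nonneg in blast)
  have P_zero: "P x = 0" if "x \<le> \<epsilon>" for x using P0(2)[OF that] by (simp add: P_def)
  have P_one: "P x = 1" if "2 * \<epsilon> \<le> x" for x
  proof (cases "2 * \<epsilon> = x")
    case False
    then have "2 * \<epsilon> < x" using that by simp
    then obtain z where "2 * \<epsilon> < z" "P x - P (2 * \<epsilon>) = (x - 2 * \<epsilon>) * \<rho> z"
      using MVT2[of "2 * \<epsilon>" x P \<rho>] P by blast
    then show ?thesis using \<rho>_zero[of z] \<open>c > 0\<close> by (simp add: P_def c_def)
  qed (use \<open>c > 0\<close> in \<open>simp add: P_def c_def\<close>)
  have P_nonneg: "0 \<le> P x" for x using P_mono[of "min x \<epsilon>" x] P_zero[of "min x \<epsilon>"] by simp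
  have P_le: "P x \<le> 1" for x using P_mono[of x "max x (2 * \<epsilon>)"] P_one[of "max x (2 * \<epsilon>)"] by simp
  define Q where "Q x = integral {0..x} P" for x
  have Q: "(Q has_real_derivative P x) (at x)" "x \<le> \<epsilon> \<Longrightarrow> Q x = 0" for x
    unfolding Q_def[abs_def]
    by (rule integral_has_derivative_of_right_supported[OF cont[OF smooth_P] assms]; simp add: P_zero)+
  have smooth_Q: "times_differentiable n Q" for n using Q(1) smooth_P by (cases n) (simp, auto intro: times_differentiable_SucI)
  have Q_affine: "Q x = Q (2 * \<epsilon>) + (x - 2 * \<epsilon>)" if "2 * \<epsilon> \<le> x" for x
  proof (cases "2 * \<epsilon> = x")
    case False
    then have "2 * \<epsilon> < x" using that by simp
    then obtain z where "2 * \<epsilon> < z" "Q x - Q (2 * \<epsilon>) = (x - 2 * \<epsilon>) * P z"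
      using MVT2[of "2 * \<epsilon>" x Q P] Q by blast
    then show ?thesis using P_one[of z] by simp
  qed simp
  show ?thesis
    by (rule that[of \<rho> P Q], unfold_locales; fact assms P Q cont_\<rho> smooth_P smooth_Q \<rho>_nonneg \<rho>_zero
        P_zero P_one P_nonneg P_le Q_affine)
qed

section \<open>Differences of functions with bounded weak derivatives\<close>

lemma test_functionI:
  assumes "\<And>n. times_differentiable n \<psi>" "\<And>x. x \<notin> {c..d} \<Longrightarrow> \<psi> x = 0" "0 < c" "d < T"
  shows "\<psi> \<in> test_functions T"
proof -
  have "closure {t. \<psi> t \<noteq> 0} \<subseteq> {c..d}"
  proof (intro closure_minimal subsetI)
    show "t \<in> {c..d}" if "t \<in> {t. \<psi> t \<noteq> 0}" for t
      using that assms(2)[of t] by (rule_tac ccontr) simp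
  qed simp
  then show ?thesis
    using assms by (auto simp: test_functions_def times_differentiable_imp_higher_deriv)
qed

text \<open>Moving all derivatives onto the test function turns the pairing with \<open>u\<close> into, up to sign, the
  pairing with \<open>g\<close>. The null set on which \<open>g\<close> may exceed its bound is removed by a change of the
  integrand that does not affect the integral.\<close>

lemma weak_derivative_pairing_bound:
  fixes u g :: "real \<Rightarrow> 'a::banach"
  assumes weak: "weak_derivative T n u g" and \<psi>: "\<psi> \<in> test_functions T"
    and bound: "AE t in lebesgue_on {0<..<T}. norm (g t) \<le> B" "0 \<le> B"
    and le: "\<And>x. \<bar>\<psi> x\<bar> \<le> M" and supp: "\<And>x. x \<notin> {c..d} \<Longrightarrow> \<psi> x = 0"
    and cd: "0 < c" "c \<le> d" "d < T"
    and int: "((\<lambda>t. (deriv ^^ n) \<psi> t *\<^sub>R u t) has_integral I) {0..T}"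
  shows "norm I \<le> B * M * (d - c)"
proof -
  have M: "0 \<le> M" using le[of 0] by linarith
  obtain I' where I': "((\<lambda>t. (deriv ^^ n) \<psi> t *\<^sub>R u t) has_integral I') {0..T}"
    "((\<lambda>t. \<psi> t *\<^sub>R g t) has_integral ((-1) ^ n *\<^sub>R I')) {0..T}"
    using weak \<psi> unfolding weak_derivative_def by blast
  have "I' = I" using has_integral_unique[OF I'(1) int] .
  with I'(2) have J: "((\<lambda>t. \<psi> t *\<^sub>R g t) has_integral ((-1) ^ n *\<^sub>R I)) {0..T}" by simp
  define S where "S = {t \<in> {0<..<T}. \<not> norm (g t) \<le> B}"
  have "negligible S"
  proof -
    have "AE t in lebesgue. t \<in> {0<..<T} \<longrightarrow> norm (g t) \<le> B"
      using bound(1) by (simp add: AE_restrict_space_iff)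
    then have "{t. \<not> (t \<in> {0<..<T} \<longrightarrow> norm (g t) \<le> B)} \<in> null_sets lebesgue"
      by (simp add: completion.AE_iff_null_sets)
    moreover have "S = {t. \<not> (t \<in> {0<..<T} \<longrightarrow> norm (g t) \<le> B)}" by (auto simp: S_def)
    ultimately show ?thesis by (simp add: negligible_iff_null_sets)
  qed
  have "((\<lambda>t. if t \<in> {c..d} then if t \<in> S then 0 else \<psi> t *\<^sub>R g t else 0)
           has_integral ((-1) ^ n *\<^sub>R I)) {0..T}"
    by (rule has_integral_spike[OF \<open>negligible S\<close> _ J]) (use supp in auto)
  then have "((\<lambda>t. if t \<in> S then 0 else \<psi> t *\<^sub>R g t) has_integral ((-1) ^ n *\<^sub>R I)) {c..d}"
    by (subst (asm) has_integral_restrict) (use cd in auto)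
  then have "norm ((-1) ^ n *\<^sub>R I) \<le> (B * M) * measure lborel (cbox c d)"
  proof (intro has_integral_bound)
    fix t assume "t \<in> cbox c d"
    then have "t \<notin> S \<Longrightarrow> norm (g t) \<le> B" using cd by (auto simp: S_def)
    then show "norm (if t \<in> S then 0 else \<psi> t *\<^sub>R g t) \<le> B * M"
      using le[of t] M bound(2) by (auto simp: mult.commute[of B] intro!: mult_mono)
  qed (use M bound(2) in auto)
  then show ?thesis using cd by simp
qed

context smooth_step
begin

lemma step_shift_deriv: "((\<lambda>s. P (s - c)) has_real_derivative \<rho> (s - c)) (at s within S)"
  using DERIV_chain2[where f = P and g = "\<lambda>s. s - c", OF step_deriv DERIV_diff[OF DERIV_ident DERIV_const]]
  by simp

lemma ramp_shift_deriv: "((\<lambda>s. Q (s - c)) has_real_derivative P (s - c)) (at s within S)"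
  using DERIV_chain2[where f = Q and g = "\<lambda>s. s - c", OF ramp_deriv DERIV_diff[OF DERIV_ident DERIV_const]]
  by simp

text \<open>The translated mollifier has total mass 1 because the step rises from 0 to 1 inside the interval, so
  the error is an average of the deviations from \<open>u a\<close> over the window.\<close>

lemma mollified_value_close:
  fixes u :: "real \<Rightarrow> 'a::banach"
  assumes u: "continuous_on {0..T} u" and a: "0 \<le> a" "a + 2 * \<epsilon> < T"
    and close: "\<And>s. s \<in> {a..a + 2 * \<epsilon>} \<Longrightarrow> norm (u s - u a) \<le> \<eta>"
  obtains J where "((\<lambda>s. \<rho> (s - a) *\<^sub>R u s) has_integral J) {0..T}" "norm (J - u a) \<le> \<eta>"
proof -
  note \<epsilon> = width_pos
  have mass: "((\<lambda>s. \<rho> (s - a)) has_integral (P (T - a) - P (0 - a))) {0..T}"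
  proof (rule fundamental_theorem_of_calculus)
    fix s
    show "((\<lambda>s. P (s - a)) has_vector_derivative \<rho> (s - a)) (at s within {0..T})"
      using step_shift_deriv by (simp add: has_real_derivative_iff_has_vector_derivative)
  qed (use a \<epsilon> in simp)
  then have mass: "((\<lambda>s. \<rho> (s - a)) has_integral 1) {0..T}" using step_left[of "- a"] step_right[of "T - a"] a \<epsilon> by simp
  have \<rho>_cont: "continuous_on {0..T} (\<lambda>s. \<rho> (s - a))"
    by (rule continuous_on_compose2[OF bump_cont]) (auto intro!: continuous_intros)
  then have "(\<lambda>s. \<rho> (s - a) *\<^sub>R u s) integrable_on {0..T}"
    using u by (intro integrable_continuous_real continuous_intros)
  then obtain J where J: "((\<lambda>s. \<rho> (s - a) *\<^sub>R u s) has_integral J) {0..T}"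
    by (auto simp: integrable_on_def)
  have "((\<lambda>s. \<rho> (s - a) *\<^sub>R u s - \<rho> (s - a) *\<^sub>R u a) has_integral (J - 1 *\<^sub>R u a)) {0..T}"
    by (intro has_integral_diff J has_integral_scaleR_left mass)
  then have D: "((\<lambda>s. \<rho> (s - a) *\<^sub>R (u s - u a)) has_integral (J - u a)) {0..T}"
    by (simp add: scaleR_diff_right)
  have E: "((\<lambda>s. \<rho> (s - a) * \<eta>) has_integral (1 * \<eta>)) {0..T}"
    by (intro has_integral_mult_left mass)
  have "norm (integral {0..T} (\<lambda>s. \<rho> (s - a) *\<^sub>R (u s - u a))) \<le> integral {0..T} (\<lambda>s. \<rho> (s - a) * \<eta>)"
  proof (rule integral_norm_bound_integral)
    fix s
    show "norm (\<rho> (s - a) *\<^sub>R (u s - u a)) \<le> \<rho> (s - a) * \<eta>"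
    proof (cases "s - a \<in> {\<epsilon><..<2 * \<epsilon>}")
      case True
      then show ?thesis using close[of s] bump_nonneg[of "s - a"] a by (auto intro!: mult_left_mono)
    next
      case False
      then show ?thesis by (simp add: bump_supp)
    qed
  qed (use D E in \<open>auto simp: integrable_on_def\<close>)
  then have "norm (J - u a) \<le> \<eta>"
    unfolding integral_unique[OF D] integral_unique[OF E] by simp
  with J show ?thesis by (rule that)
qed

end

text \<open>For small widths, the window \<open>{a..a + 2 * \<epsilon>}\<close> that a mollifier at \<open>a\<close> sees fits into the
  interval, and \<open>u\<close> is nearly constant on it. Formulated as an eventuality so that the
  conditions for several base points can be intersected.\<close>

lemma eventually_close_to_the_right:
  fixes u :: "real \<Rightarrow> 'a::real_normed_vector"
  assumes "continuous_on {0..T} u" "0 \<le> a" "a < T" "0 < \<eta>"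
  shows "\<forall>\<^sub>F \<epsilon> in at_right 0. a + 2 * \<epsilon> < T \<and> (\<forall>s\<in>{a..a + 2 * \<epsilon>}. norm (u s - u a) \<le> \<eta>)"
proof -
  obtain d where d: "d > 0" "\<And>s. s \<in> {0..T} \<Longrightarrow> dist s a < d \<Longrightarrow> dist (u s) (u a) < \<eta>"
    using assms unfolding continuous_on_iff by (metis atLeastAtMost_iff less_imp_le)
  define m where "m = min d (T - a) / 2"
  have "m > 0" using d assms by (simp add: m_def)
  then show ?thesis
  proof (rule eventually_at_rightI[of 0 m, rotated])
    fix \<epsilon> assume "\<epsilon> \<in> {0<..<m}"
    then have \<epsilon>: "0 < \<epsilon>" "2 * \<epsilon> < d" "a + 2 * \<epsilon> < T" by (auto simp: m_def)
    show "a + 2 * \<epsilon> < T \<and> (\<forall>s\<in>{a..a + 2 * \<epsilon>}. norm (u s - u a) \<le> \<eta>)"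
    proof (intro conjI ballI)
      fix s assume "s \<in> {a..a + 2 * \<epsilon>}"
      then have "s \<in> {0..T}" "dist s a < d" using \<epsilon> assms by (auto simp: dist_real_def)
      from d(2)[OF this] show "norm (u s - u a) \<le> \<eta>" by (simp add: dist_norm)
    qed (use \<epsilon> in simp)
  qed
qed

text \<open>The test function is a smoothed indicator function of \<open>{a..a + h}\<close>: it has values in
  \<open>{0..1}\<close> and support of length \<open>h + \<epsilon>\<close>.\<close>

lemma weak_derivative_imp_difference_bound:
  fixes u g :: "real \<Rightarrow> 'a::banach"
  assumes u: "continuous_on {0..T} u" and weak: "weak_derivative T 1 u g"
    and bound: "AE t in lebesgue_on {0<..<T}. norm (g t) \<le> B" "0 \<le> B"
    and a: "0 \<le> a" "0 \<le> h" "a + h < T"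
  shows "norm (u (a + h) - u a) \<le> B * h"
proof (rule field_le_epsilon)
  fix e :: real assume "0 < e"
  have ah: "0 \<le> a + h" using a by linarith
  \<comment> \<open>Each of the two mollified values costs \<open>\<eta>\<close>, the enlarged support at most \<open>B * \<eta>\<close>.\<close>
  define \<eta> where "\<eta> = e / (B + 2)"
  have "\<eta> > 0" using \<open>0 < e\<close> bound(2) by (simp add: \<eta>_def)
  have "\<forall>\<^sub>F \<epsilon> in at_right 0. 0 < \<epsilon> \<and> \<epsilon> < \<eta> \<and>
      (a + 2 * \<epsilon> < T \<and> (\<forall>s\<in>{a..a + 2 * \<epsilon>}. norm (u s - u a) \<le> \<eta>)) \<and>
      (a + h + 2 * \<epsilon> < T \<and> (\<forall>s\<in>{a + h..a + h + 2 * \<epsilon>}. norm (u s - u (a + h)) \<le> \<eta>))"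
    using a \<open>\<eta> > 0\<close>
    by (intro eventually_conj eventually_close_to_the_right u eventually_at_right_less
        eventually_at_rightI[of 0 \<eta>]) auto
  then obtain \<epsilon> where \<epsilon>: "0 < \<epsilon>" "\<epsilon> < \<eta>" "a + 2 * \<epsilon> < T" "a + h + 2 * \<epsilon> < T"
    "\<And>s. s \<in> {a..a + 2 * \<epsilon>} \<Longrightarrow> norm (u s - u a) \<le> \<eta>"
    "\<And>s. s \<in> {a + h..a + h + 2 * \<epsilon>} \<Longrightarrow> norm (u s - u (a + h)) \<le> \<eta>"
    using eventually_happens'[OF trivial_limit_at_right_real] by blast
  obtain \<rho> P Q where "smooth_step \<epsilon> \<rho> P Q"
    by (rule smooth_step_exists[OF \<epsilon>(1)])
  then interpret smooth_step \<epsilon> \<rho> P Q .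
  obtain J0 where J0: "((\<lambda>s. \<rho> (s - a) *\<^sub>R u s) has_integral J0) {0..T}" "norm (J0 - u a) \<le> \<eta>"
    by (rule mollified_value_close[OF u a(1) \<epsilon>(3) \<epsilon>(5)])
  obtain J1 where J1: "((\<lambda>s. \<rho> (s - (a + h)) *\<^sub>R u s) has_integral J1) {0..T}"
    "norm (J1 - u (a + h)) \<le> \<eta>"
    by (rule mollified_value_close[OF u ah \<epsilon>(4) \<epsilon>(6)])
  \<comment> \<open>The arguments \<open>1 * s + - c\<close> let smoothness under affine substitution apply literally.\<close>
  define \<psi> where "\<psi> s = P (1 * s + - a) + (-1) * P (1 * s + - (a + h))" for s
  have smooth_\<psi>: "times_differentiable n \<psi>" for n
    unfolding \<psi>_def[abs_def]
    by (rule times_differentiable_add[OF times_differentiable_affine_compose[OF step_smooth]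
          times_differentiable_mult[OF times_differentiable_const times_differentiable_affine_compose[OF step_smooth]]])
  have \<psi>_eq: "\<psi> = (\<lambda>s. P (s - a) - P (s - (a + h)))"
    by (rule ext) (simp only: \<psi>_def mult_1 mult_minus1 add_uminus_conv_diff)
  have supp: "\<psi> s = 0" if "s \<notin> {a + \<epsilon>..a + h + 2 * \<epsilon>}" for s
    using that a \<epsilon>(1) step_left[of "s - a"] step_left[of "s - (a + h)"] step_right[of "s - a"] step_right[of "s - (a + h)"]
    by (auto simp: \<psi>_eq)
  have "(\<psi> has_real_derivative (\<rho> (s - a) - \<rho> (s - (a + h)))) (at s)" for s
    unfolding \<psi>_eq by (intro DERIV_diff step_shift_deriv)
  then have "deriv \<psi> = (\<lambda>s. \<rho> (s - a) - \<rho> (s - (a + h)))"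
    by (intro ext DERIV_imp_deriv)
  then have "((\<lambda>s. (deriv ^^ 1) \<psi> s *\<^sub>R u s) has_integral (J0 - J1)) {0..T}"
    using has_integral_diff[OF J0(1) J1(1)] by (simp add: scaleR_diff_left)
  then have "norm (J0 - J1) \<le> B * 1 * (a + h + 2 * \<epsilon> - (a + \<epsilon>))"
  proof (rule weak_derivative_pairing_bound[OF weak _ bound, rotated -1])
    show "\<psi> \<in> test_functions T" by (rule test_functionI[OF smooth_\<psi> supp]) (use a \<epsilon> in auto)
    show "\<bar>\<psi> s\<bar> \<le> 1" for s
      using step_nonneg[of "s - a"] step_le_1[of "s - a"]
        step_nonneg[of "s - (a + h)"] step_le_1[of "s - (a + h)"] by (simp add: \<psi>_eq abs_le_iff)
  qed (use a \<epsilon> supp in auto)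
  then have main: "norm (J0 - J1) \<le> B * h + B * \<epsilon>" by (simp add: algebra_simps)
  have "u (a + h) - u a = (J1 - J0) - (J1 - u (a + h)) + (J0 - u a)" by simp
  then have "norm (u (a + h) - u a) \<le> norm (J1 - J0) + norm (J1 - u (a + h)) + norm (J0 - u a)"
    by (metis (no_types, opaque_lifting) norm_triangle_ineq norm_triangle_ineq4 add_right_mono order_trans)
  also have "\<dots> \<le> B * h + B * \<epsilon> + \<eta> + \<eta>"
    using main J0(2) J1(2) by (simp add: norm_minus_commute)
  also have "\<dots> \<le> B * h + (B + 2) * \<eta>"
    using mult_left_mono[OF less_imp_le[OF \<epsilon>(2)] bound(2)] by (simp add: algebra_simps)
  also have "\<dots> = B * h + e" using bound(2) by (simp add: \<eta>_def)
  finally show "norm (u (a + h) - u a) \<le> B * h + e" .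
qed

text \<open>The test function is the second difference of the ramp, a smoothed hat on \<open>{a..a + 2 * h}\<close>.
  It is estimated crudely by its height \<open>h\<close> times the length \<open>2 * h + \<epsilon>\<close> of its support, which
  doubles the true mass \<open>h\<^sup>2\<close> and accounts for the factor 2 in the bound.\<close>

lemma weak_derivative_imp_second_difference_bound:
  fixes u g :: "real \<Rightarrow> 'a::banach"
  assumes u: "continuous_on {0..T} u" and weak: "weak_derivative T 2 u g"
    and bound: "AE t in lebesgue_on {0<..<T}. norm (g t) \<le> B" "0 \<le> B"
    and a: "0 \<le> a" "0 \<le> h" "a + 2 * h < T"
  shows "norm (u (a + 2 * h) - 2 *\<^sub>R u (a + h) + u a) \<le> 2 * B * h\<^sup>2"
proof (rule field_le_epsilon)
  fix e :: real assume "0 < e"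
  have ah: "0 \<le> a + h" "0 \<le> a + 2 * h" using a by linarith+
  \<comment> \<open>The mollified values enter with weights 1, 2, 1, and the enlarged support costs at most \<open>B * h * \<eta>\<close>.\<close>
  define \<eta> where "\<eta> = e / (B * h + 4)"
  have den: "B * h + 4 > 0" using a bound(2) by (simp add: add_nonneg_pos)
  have "\<eta> > 0" using \<open>0 < e\<close> den by (simp add: \<eta>_def)
  have "\<forall>\<^sub>F \<epsilon> in at_right 0. 0 < \<epsilon> \<and> \<epsilon> < \<eta> \<and>
      (a + 2 * \<epsilon> < T \<and> (\<forall>s\<in>{a..a + 2 * \<epsilon>}. norm (u s - u a) \<le> \<eta>)) \<and>
      (a + h + 2 * \<epsilon> < T \<and> (\<forall>s\<in>{a + h..a + h + 2 * \<epsilon>}. norm (u s - u (a + h)) \<le> \<eta>)) \<and>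
      (a + 2 * h + 2 * \<epsilon> < T \<and>
        (\<forall>s\<in>{a + 2 * h..a + 2 * h + 2 * \<epsilon>}. norm (u s - u (a + 2 * h)) \<le> \<eta>))"
    using a \<open>\<eta> > 0\<close>
    by (intro eventually_conj eventually_close_to_the_right u eventually_at_right_less
        eventually_at_rightI[of 0 \<eta>]) auto
  then obtain \<epsilon> where \<epsilon>: "0 < \<epsilon>" "\<epsilon> < \<eta>" "a + 2 * \<epsilon> < T" "a + h + 2 * \<epsilon> < T" "a + 2 * h + 2 * \<epsilon> < T"
    "\<And>s. s \<in> {a..a + 2 * \<epsilon>} \<Longrightarrow> norm (u s - u a) \<le> \<eta>"
    "\<And>s. s \<in> {a + h..a + h + 2 * \<epsilon>} \<Longrightarrow> norm (u s - u (a + h)) \<le> \<eta>"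
    "\<And>s. s \<in> {a + 2 * h..a + 2 * h + 2 * \<epsilon>} \<Longrightarrow> norm (u s - u (a + 2 * h)) \<le> \<eta>"
    using eventually_happens'[OF trivial_limit_at_right_real] by blast
  obtain \<rho> P Q where "smooth_step \<epsilon> \<rho> P Q"
    by (rule smooth_step_exists[OF \<epsilon>(1)])
  then interpret smooth_step \<epsilon> \<rho> P Q .
  obtain J0 where J0: "((\<lambda>s. \<rho> (s - a) *\<^sub>R u s) has_integral J0) {0..T}" "norm (J0 - u a) \<le> \<eta>"
    by (rule mollified_value_close[OF u a(1) \<epsilon>(3) \<epsilon>(6)])
  obtain J1 where J1: "((\<lambda>s. \<rho> (s - (a + h)) *\<^sub>R u s) has_integral J1) {0..T}"
    "norm (J1 - u (a + h)) \<le> \<eta>"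
    by (rule mollified_value_close[OF u ah(1) \<epsilon>(4) \<epsilon>(7)])
  obtain J2 where J2: "((\<lambda>s. \<rho> (s - (a + 2 * h)) *\<^sub>R u s) has_integral J2) {0..T}"
    "norm (J2 - u (a + 2 * h)) \<le> \<eta>"
    by (rule mollified_value_close[OF u ah(2) \<epsilon>(5) \<epsilon>(8)])
  define \<psi> where "\<psi> s = Q (1 * s + - a) + (-2) * Q (1 * s + - (a + h)) + Q (1 * s + - (a + 2 * h))" for s
  have smooth_\<psi>: "times_differentiable n \<psi>" for n
    unfolding \<psi>_def[abs_def]
    by (rule times_differentiable_add[OF times_differentiable_add[OF
          times_differentiable_affine_compose[OF ramp_smooth]
          times_differentiable_mult[OF times_differentiable_const times_differentiable_affine_compose[OF ramp_smooth]]]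
          times_differentiable_affine_compose[OF ramp_smooth]])
  have \<psi>_eq: "\<psi> = (\<lambda>s. Q (s - a) - 2 * Q (s - (a + h)) + Q (s - (a + 2 * h)))"
    by (rule ext) (simp only: \<psi>_def mult_1 add_uminus_conv_diff)
  have supp: "\<psi> s = 0" if "s \<notin> {a + \<epsilon>..a + 2 * h + 2 * \<epsilon>}" for s
  proof -
    have "s < a + \<epsilon> \<or> a + 2 * h + 2 * \<epsilon> < s" using that by auto
    then show ?thesis
    proof
      assume "s < a + \<epsilon>"
      then show ?thesis
        using a ramp_left[of "s - a"] ramp_left[of "s - (a + h)"] ramp_left[of "s - (a + 2 * h)"]
        by (simp add: \<psi>_eq)
    next
      assume "a + 2 * h + 2 * \<epsilon> < s"
      then show ?thesis
        using a ramp_right[of "s - a"] ramp_right[of "s - (a + h)"] ramp_right[of "s - (a + 2 * h)"]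
        by (simp add: \<psi>_eq)
    qed
  qed
  have Q_diff: "0 \<le> Q (x + h) - Q x" "Q (x + h) - Q x \<le> h" for x
  proof -
    have "\<exists>z. Q (x + h) - Q x = h * P z"
    proof (cases "h = 0")
      case False
      then show ?thesis using MVT2[of x "x + h" Q P] ramp_deriv a(2) by auto
    qed simp
    then obtain z where "Q (x + h) - Q x = h * P z" by blast
    then show "0 \<le> Q (x + h) - Q x" "Q (x + h) - Q x \<le> h"
      using step_nonneg[of z] step_le_1[of z] a(2) by (auto simp: mult_left_le)
  qed
  have \<psi>_le: "\<bar>\<psi> s\<bar> \<le> h" for s
  proof -
    have e: "s - (a + h) + h = s - a" "s - (a + 2 * h) + h = s - (a + h)" by simp_all
    show ?thesis
      using Q_diff[of "s - (a + h)", unfolded e(1)] Q_diff[of "s - (a + 2 * h)", unfolded e(2)]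
      unfolding \<psi>_eq by linarith
  qed
  have d1: "deriv \<psi> = (\<lambda>s. P (s - a) - 2 * P (s - (a + h)) + P (s - (a + 2 * h)))"
    unfolding \<psi>_eq
    by (intro ext DERIV_imp_deriv DERIV_add DERIV_diff DERIV_cmult ramp_shift_deriv)
  have d2: "deriv (deriv \<psi>) = (\<lambda>s. \<rho> (s - a) - 2 * \<rho> (s - (a + h)) + \<rho> (s - (a + 2 * h)))"
    unfolding d1
    by (intro ext DERIV_imp_deriv DERIV_add DERIV_diff DERIV_cmult step_shift_deriv)
  have "((\<lambda>s. (deriv ^^ 2) \<psi> s *\<^sub>R u s) has_integral (J0 - 2 *\<^sub>R J1 + J2)) {0..T}"
    using has_integral_add[OF has_integral_diff[OF J0(1) has_integral_cmul[OF J1(1), of 2]] J2(1)]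
    by (simp add: eval_nat_numeral d2 scaleR_diff_left scaleR_add_left)
  then have "norm (J0 - 2 *\<^sub>R J1 + J2) \<le> B * h * (a + 2 * h + 2 * \<epsilon> - (a + \<epsilon>))"
    by (rule weak_derivative_pairing_bound[OF weak test_functionI[OF smooth_\<psi> supp] bound \<psi>_le supp, rotated -1])
      (use a \<epsilon> in auto)
  then have main: "norm (J0 - 2 *\<^sub>R J1 + J2) \<le> 2 * B * h\<^sup>2 + B * h * \<epsilon>"
    by (simp add: algebra_simps power2_eq_square)
  define X where "X = J0 - 2 *\<^sub>R J1 + J2"
  have "u (a + 2 * h) - 2 *\<^sub>R u (a + h) + u a =
      (X - (J0 - u a)) + (2 *\<^sub>R (J1 - u (a + h)) - (J2 - u (a + 2 * h)))"
    by (simp add: X_def algebra_simps)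
  also have "norm \<dots> \<le> (norm X + norm (J0 - u a)) + (norm (2 *\<^sub>R (J1 - u (a + h))) + norm (J2 - u (a + 2 * h)))"
    by (intro norm_triangle_mono norm_triangle_ineq4)
  also have "\<dots> \<le> 2 * B * h\<^sup>2 + B * h * \<epsilon> + \<eta> + (2 * \<eta> + \<eta>)"
    using main J0(2) J1(2) J2(2) by (simp add: X_def)
  also have "\<dots> \<le> 2 * B * h\<^sup>2 + (B * h + 4) * \<eta>"
    using mult_left_mono[OF less_imp_le[OF \<epsilon>(2)], of "B * h"] bound(2) a(2) by (simp add: algebra_simps)
  also have "\<dots> = 2 * B * h\<^sup>2 + e" using den by (simp add: \<eta>_def)
  finally show "norm (u (a + 2 * h) - 2 *\<^sub>R u (a + h) + u a) \<le> 2 * B * h\<^sup>2 + e" .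
qed

section \<open>Regularity in terms of first and second differences\<close>

text \<open>A discrete Leibniz rule, expanded around the middle node: the mixed terms are products of two
  first differences and hence of second order as well.\<close>

lemma product_second_difference_bound:
  fixes q0 q1 q2 :: "'a::real_normed_vector \<Rightarrow>\<^sub>L 'b::real_normed_vector" and u0 u1 u2 :: 'a
  shows "norm (q2 u2 - 2 *\<^sub>R q1 u1 + q0 u0)
    \<le> norm q1 * norm (u2 - 2 *\<^sub>R u1 + u0) + norm (q2 - 2 *\<^sub>R q1 + q0) * norm u1
      + norm (q2 - q1) * norm (u2 - u1) + norm (q1 - q0) * norm (u1 - u0)"
proof -
  have "q2 u2 - 2 *\<^sub>R q1 u1 + q0 u0 = q1 (u2 - 2 *\<^sub>R u1 + u0) + (q2 - 2 *\<^sub>R q1 + q0) u1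
      + (q2 - q1) (u2 - u1) + (q1 - q0) (u1 - u0)"
    by (simp add: blinfun.bilinear_simps algebra_simps scaleR_2)
  also have "norm \<dots> \<le> norm q1 * norm (u2 - 2 *\<^sub>R u1 + u0) + norm (q2 - 2 *\<^sub>R q1 + q0) * norm u1
      + norm (q2 - q1) * norm (u2 - u1) + norm (q1 - q0) * norm (u1 - u0)"
    by (intro norm_triangle_mono norm_blinfun)
  finally show ?thesis .
qed

text \<open>A quantitative form of \<open>C\<^sup>1\<^sup>,\<^sup>1\<close> regularity in terms of differences only. A single constant serves for
  all three bounds, since only the existence of a constant matters in the end.\<close>

definition C11_bound :: "real \<Rightarrow> real \<Rightarrow> (real \<Rightarrow> 'a::real_normed_vector) \<Rightarrow> bool" where
  "C11_bound T B g \<longleftrightarrow> 0 \<le> B \<and> (\<forall>s\<in>{0..T}. norm (g s) \<le> B) \<and>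
     (\<forall>s h. 0 \<le> s \<longrightarrow> 0 \<le> h \<longrightarrow> s + h \<le> T \<longrightarrow> norm (g (s + h) - g s) \<le> B * h) \<and>
     (\<forall>s h. 0 \<le> s \<longrightarrow> 0 \<le> h \<longrightarrow> s + 2 * h \<le> T \<longrightarrow>
        norm (g (s + 2 * h) - 2 *\<^sub>R g (s + h) + g s) \<le> B * h\<^sup>2)"

lemma C11_boundI:
  assumes "0 \<le> B" "\<And>s. s \<in> {0..T} \<Longrightarrow> norm (g s) \<le> B"
    "\<And>s h. 0 \<le> s \<Longrightarrow> 0 \<le> h \<Longrightarrow> s + h \<le> T \<Longrightarrow> norm (g (s + h) - g s) \<le> B * h"
    "\<And>s h. 0 \<le> s \<Longrightarrow> 0 \<le> h \<Longrightarrow> s + 2 * h \<le> T \<Longrightarrow>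
       norm (g (s + 2 * h) - 2 *\<^sub>R g (s + h) + g s) \<le> B * h\<^sup>2"
  shows "C11_bound T B g"
  using assms by (simp add: C11_bound_def)

lemma C11_boundD:
  assumes "C11_bound T B g"
  shows "0 \<le> B"
    and "0 \<le> s \<Longrightarrow> s \<le> T \<Longrightarrow> norm (g s) \<le> B"
    and "0 \<le> s \<Longrightarrow> 0 \<le> h \<Longrightarrow> s + h \<le> T \<Longrightarrow> norm (g (s + h) - g s) \<le> B * h"
    and "0 \<le> s \<Longrightarrow> 0 \<le> h \<Longrightarrow> s + 2 * h \<le> T \<Longrightarrow>
       norm (g (s + 2 * h) - 2 *\<^sub>R g (s + h) + g s) \<le> B * h\<^sup>2"
  using assms by (simp_all add: C11_bound_def)

lemma C11_bound_mono: "C11_bound T B g \<Longrightarrow> t \<le> T \<Longrightarrow> C11_bound t B g"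
  unfolding C11_bound_def by auto

lemma C11_bound_imp_continuous:
  assumes "C11_bound T B g"
  shows "continuous_on {0..T} g"
proof -
  have "B-lipschitz_on {0..T} g"
  proof (rule lipschitz_on_leI)
    fix x y assume "x \<in> {0..T}" "y \<in> {0..T}" "x \<le> y"
    then show "dist (g x) (g y) \<le> B * dist x y"
      using C11_boundD(3)[OF assms, of x "y - x"] by (simp add: dist_norm norm_minus_commute)
  qed (use C11_boundD(1)[OF assms] in simp)
  then show ?thesis by (rule lipschitz_on_continuous_on)
qed

lemma C11_bound_blinfun_apply:
  fixes q :: "real \<Rightarrow> 'a::real_normed_vector \<Rightarrow>\<^sub>L 'b::real_normed_vector" and u :: "real \<Rightarrow> 'a"
  assumes q: "C11_bound T B q" and u: "C11_bound T U u"
  shows "C11_bound T (4 * B * U) (\<lambda>s. q s (u s))"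
proof (rule C11_boundI)
  note nonneg = C11_boundD(1)[OF q] C11_boundD(1)[OF u]
  then have BU: "0 \<le> B * U" by simp
  then show "0 \<le> 4 * B * U" by simp
  show "norm (q s (u s)) \<le> 4 * B * U" if "s \<in> {0..T}" for s
  proof -
    have "norm (q s (u s)) \<le> norm (q s) * norm (u s)" by (rule norm_blinfun)
    also have "\<dots> \<le> B * U"
      using that nonneg by (intro mult_mono C11_boundD(2)[OF q] C11_boundD(2)[OF u]) auto
    finally show ?thesis using BU by simp
  qed
  show "norm (q (s + h) (u (s + h)) - q s (u s)) \<le> 4 * B * U * h" if s: "0 \<le> s" "0 \<le> h" "s + h \<le> T" for s h
  proof -
    have "q (s + h) (u (s + h)) - q s (u s) = (q (s + h) - q s) (u (s + h)) + q s (u (s + h) - u s)"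
      by (simp add: blinfun.bilinear_simps)
    also have "norm \<dots> \<le> norm (q (s + h) - q s) * norm (u (s + h)) + norm (q s) * norm (u (s + h) - u s)"
      by (intro norm_triangle_mono norm_blinfun)
    also have "\<dots> \<le> (B * h) * U + B * (U * h)"
      using s nonneg by (intro add_mono mult_mono C11_boundD(2,3)[OF q] C11_boundD(2,3)[OF u]) auto
    also have "\<dots> = 2 * (B * U * h)" by simp
    also have "\<dots> \<le> 4 * B * U * h" using mult_nonneg_nonneg[OF BU s(2)] by simp
    finally show ?thesis .
  qed
  show "norm (q (s + 2 * h) (u (s + 2 * h)) - 2 *\<^sub>R q (s + h) (u (s + h)) + q s (u s)) \<le> 4 * B * U * h\<^sup>2"
    if s: "0 \<le> s" "0 \<le> h" "s + 2 * h \<le> T" for s h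
  proof -
    have q2: "norm (q (s + 2 * h) - q (s + h)) \<le> B * h" and u2: "norm (u (s + 2 * h) - u (s + h)) \<le> U * h"
      using C11_boundD(3)[OF q, of "s + h" h] C11_boundD(3)[OF u, of "s + h" h] s
      by (simp_all add: add.assoc)
    have "norm (q (s + 2 * h) (u (s + 2 * h)) - 2 *\<^sub>R q (s + h) (u (s + h)) + q s (u s))
      \<le> norm (q (s + h)) * norm (u (s + 2 * h) - 2 *\<^sub>R u (s + h) + u s)
        + norm (q (s + 2 * h) - 2 *\<^sub>R q (s + h) + q s) * norm (u (s + h))
        + norm (q (s + 2 * h) - q (s + h)) * norm (u (s + 2 * h) - u (s + h))
        + norm (q (s + h) - q s) * norm (u (s + h) - u s)"
      by (rule product_second_difference_bound)
    also have "\<dots> \<le> B * (U * h\<^sup>2) + (B * h\<^sup>2) * U + (B * h) * (U * h) + (B * h) * (U * h)"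
      using s nonneg
      by (intro add_mono mult_mono q2 u2 C11_boundD(2-4)[OF q] C11_boundD(2-4)[OF u]) auto
    also have "\<dots> = 4 * B * U * h\<^sup>2" by (simp add: power2_eq_square)
    finally show ?thesis .
  qed
qed

text \<open>The second difference in \<open>s\<close> with step \<open>h\<close> is the increment over \<open>{0..h}\<close> of the function
  \<open>F x = q (t, s + h + x) - q (t, s + x)\<close>, whose derivative is bounded by \<open>h\<close> times the
  Lipschitz constant of the derivative of \<open>q\<close>. All bounds are uniform in \<open>t\<close> because they come from
  compactness of the square.\<close>

lemma C2_kernel_imp_C11_bound:
  fixes q :: "real \<times> real \<Rightarrow> 'a::real_normed_vector \<Rightarrow>\<^sub>L 'b::real_normed_vector"
  assumes q: "C2_on ({0..} \<times> {0..}) q"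
  shows "\<exists>B. \<forall>t\<in>{0..T}. C11_bound T B (\<lambda>s. q (t, s))"
proof -
  define S :: "(real \<times> real) set" where "S = {0..} \<times> {0..}"
  define C :: "(real \<times> real) set" where "C = {0..T} \<times> {0..T}"
  have CS: "C \<subseteq> S" by (auto simp: C_def S_def)
  have C: "compact C" "convex C" by (auto simp: C_def compact_Times convex_Times)
  obtain D D2 where "\<And>p. p \<in> S \<Longrightarrow> (q has_derivative blinfun_apply (D p)) (at p within S)"
    "\<And>p. p \<in> S \<Longrightarrow> (D has_derivative blinfun_apply (D2 p)) (at p within S)"
    and D2_cont: "continuous_on S D2"
    using q unfolding C2_on_def S_def by blast
  then have D: "\<And>p. p \<in> C \<Longrightarrow> (q has_derivative blinfun_apply (D p)) (at p within C)"
    and D2: "\<And>p. p \<in> C \<Longrightarrow> (D has_derivative blinfun_apply (D2 p)) (at p within C)"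
    using CS by (blast intro: has_derivative_subset)+
  have bounded: "\<exists>B. \<forall>p\<in>C. norm (F p) \<le> B" if "continuous_on C F"
    for F :: "real \<times> real \<Rightarrow> 'c::real_normed_vector"
    using compact_imp_bounded[OF compact_continuous_image[OF that C(1)]]
    by (auto simp: bounded_iff)
  obtain B0 where B0: "\<And>p. p \<in> C \<Longrightarrow> norm (q p) \<le> B0"
    using bounded[OF has_derivative_continuous_on[OF D]] by blast
  obtain B1 where B1: "\<And>p. p \<in> C \<Longrightarrow> norm (D p) \<le> B1"
    using bounded[OF has_derivative_continuous_on[OF D2]] by blast
  obtain B2 where B2: "\<And>p. p \<in> C \<Longrightarrow> norm (D2 p) \<le> B2"
    using bounded[OF continuous_on_subset[OF D2_cont CS]] by blast
  define B where "B = Max {0, B0, B1, B2}"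
  have B: "0 \<le> B" "B0 \<le> B" "B1 \<le> B" "B2 \<le> B" by (simp_all add: B_def)
  have q_lip: "norm (q p - q p') \<le> B * norm (p - p')" if "p \<in> C" "p' \<in> C" for p p'
    by (rule differentiable_bound[OF C(2) D])
      (use that B1 B in \<open>auto simp flip: norm_blinfun.rep_eq intro: order_trans\<close>)
  have D_lip: "norm (D p - D p') \<le> B * norm (p - p')" if "p \<in> C" "p' \<in> C" for p p'
    by (rule differentiable_bound[OF C(2) D2])
      (use that B2 B in \<open>auto simp flip: norm_blinfun.rep_eq intro: order_trans\<close>)
  show ?thesis
  proof (intro exI ballI)
    fix t assume t: "t \<in> {0..T}"
    show "C11_bound T B (\<lambda>s. q (t, s))"
    proof (rule C11_boundI[OF B(1)])
      show "norm (q (t, s)) \<le> B" if "s \<in> {0..T}" for s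
        using that t B0[of "(t, s)"] B(2) by (simp add: C_def)
      show "norm (q (t, s + h) - q (t, s)) \<le> B * h" if "0 \<le> s" "0 \<le> h" "s + h \<le> T" for s h
        using that t q_lip[of "(t, s + h)" "(t, s)"] by (simp add: C_def norm_Pair)
    next
      fix s h :: real assume s: "0 \<le> s" "0 \<le> h" "s + 2 * h \<le> T"
      define F where "F x = q (t, s + h + x) - q (t, s + x)" for x
      define F' where "F' x = (\<lambda>v. D (t, s + h + x) (0, v) - D (t, s + x) (0, v))" for x
      have in_C: "(t, s + h + x) \<in> C" "(t, s + x) \<in> C" if "x \<in> {0..h}" for x
        using that t s by (auto simp: C_def)
      have "norm (F h - F 0) \<le> (B * h) * norm (h - 0)"
      proof (rule differentiable_bound[of "{0..h}" F F'])
        fix x assume x: "x \<in> {0..h}"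
        have "((\<lambda>x. q (t, c + x)) has_derivative (\<lambda>v. D (t, c + x) (0, v))) (at x within {0..h})"
          if "\<And>x. x \<in> {0..h} \<Longrightarrow> (t, c + x) \<in> C" for c
          by (rule has_derivative_in_compose2[OF D _ x]) (use that in \<open>auto intro!: derivative_eq_intros\<close>)
        then show "(F has_derivative F' x) (at x within {0..h})"
          unfolding F_def F'_def using in_C by (intro has_derivative_diff) auto
        show "onorm (F' x) \<le> B * h"
        proof (rule onorm_bound)
          fix v :: real
          have "norm (F' x v) = norm ((D (t, s + h + x) - D (t, s + x)) (0, v))"
            by (simp add: F'_def blinfun.diff_left)
          also have "\<dots> \<le> norm (D (t, s + h + x) - D (t, s + x)) * norm (0::real, v)"
            by (rule norm_blinfun)
          also have "\<dots> \<le> (B * h) * norm v"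
            using D_lip[OF in_C[OF x]] s by (auto simp: norm_Pair intro!: mult_right_mono)
          finally show "norm (F' x v) \<le> (B * h) * norm v" .
        qed (use B s in simp)
      qed (use s in auto)
      moreover have "F h - F 0 = q (t, s + 2 * h) - 2 *\<^sub>R q (t, s + h) + q (t, s)"
        by (simp add: F_def scaleR_2 algebra_simps)
      ultimately show "norm (q (t, s + 2 * h) - 2 *\<^sub>R q (t, s + h) + q (t, s)) \<le> B * h\<^sup>2"
        using s by (simp add: power2_eq_square)
    qed
  qed
qed

text \<open>The weak derivatives are taken on the longer interval \<open>{0<..<T + 1}\<close>, which leaves room
  for the test functions to the right of \<open>T\<close>.\<close>

lemma Sobolev_inf_loc_2_imp_C11_bound:
  fixes u :: "real \<Rightarrow> 'a::banach"
  assumes u: "u \<in> Sobolev_inf_loc 2" "continuous_on {0..} u" and "0 < T"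
  shows "\<exists>B. C11_bound T B u"
proof -
  have cont: "continuous_on {0..T'} u" for T' using u(2) by (rule continuous_on_subset) auto
  have "u \<in> Sobolev_inf 2 (T + 1)" using u(1) \<open>0 < T\<close> by (simp add: Sobolev_inf_loc_def)
  then have weak: "\<exists>g B. weak_derivative (T + 1) n u g \<and>
      (AE t in lebesgue_on {0<..<T + 1}. norm (g t) \<le> B)" if "n \<in> {1..2}" for n
    using that unfolding Sobolev_inf_def Linf_def by blast
  obtain g1 B1 where g1: "weak_derivative (T + 1) 1 u g1"
    "AE t in lebesgue_on {0<..<T + 1}. norm (g1 t) \<le> B1"
    using weak[of 1] by auto
  obtain g2 B2 where g2: "weak_derivative (T + 1) 2 u g2"
    "AE t in lebesgue_on {0<..<T + 1}. norm (g2 t) \<le> B2"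
    using weak[of 2] by auto
  have "bounded (u ` {0..T})"
    by (rule compact_imp_bounded[OF compact_continuous_image[OF cont compact_Icc]])
  then obtain B0 where "\<forall>x\<in>u ` {0..T}. norm x \<le> B0" unfolding bounded_iff by blast
  then have B0: "norm (u s) \<le> B0" if "s \<in> {0..T}" for s using that by blast
  define B where "B = \<bar>B0\<bar> + \<bar>B1\<bar> + 2 * \<bar>B2\<bar>"
  have "C11_bound T B u"
  proof (rule C11_boundI)
    show "norm (u s) \<le> B" if "s \<in> {0..T}" for s using B0[OF that] by (simp add: B_def)
    show "norm (u (s + h) - u s) \<le> B * h" if s: "0 \<le> s" "0 \<le> h" "s + h \<le> T" for s h
    proof -
      have "norm (u (s + h) - u s) \<le> \<bar>B1\<bar> * h"
        by (rule weak_derivative_imp_difference_bound[OF cont g1(1)])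
          (use g1(2) s in \<open>auto elim: eventually_mono\<close>)
      also have "\<dots> \<le> B * h" using s by (intro mult_right_mono) (auto simp: B_def)
      finally show ?thesis .
    qed
    show "norm (u (s + 2 * h) - 2 *\<^sub>R u (s + h) + u s) \<le> B * h\<^sup>2"
      if s: "0 \<le> s" "0 \<le> h" "s + 2 * h \<le> T" for s h
    proof -
      have "norm (u (s + 2 * h) - 2 *\<^sub>R u (s + h) + u s) \<le> 2 * \<bar>B2\<bar> * h\<^sup>2"
        by (rule weak_derivative_imp_second_difference_bound[OF cont g2(1)])
          (use g2(2) s in \<open>auto elim: eventually_mono\<close>)
      also have "\<dots> \<le> B * h\<^sup>2" using s by (intro mult_right_mono) (auto simp: B_def)
      finally show ?thesis .
    qed
  qed (simp add: B_def)
  then show ?thesis ..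
qed

section \<open>Trapezoidal quadrature\<close>

text \<open>A maximum principle. Around a point \<open>p\<close> where the norm is maximal, take the largest symmetric
  stencil inside the interval: one of its outer nodes is an end point, where the function
  vanishes, and the other one has norm at most \<open>norm (e p)\<close>. Thus \<open>2 * norm (e p)\<close> exceeds the second difference by at most
  \<open>norm (e p)\<close>. The argument works in any normed space, without a reduction to scalar
  convex functions.\<close>

lemma norm_le_of_second_differences:
  fixes e :: "real \<Rightarrow> 'a::real_normed_vector"
  assumes ab: "a \<le> b" and cont: "continuous_on {a..b} e" and "0 \<le> M"
    and sd: "\<And>x h. a \<le> x \<Longrightarrow> 0 \<le> h \<Longrightarrow> x + 2 * h \<le> b \<Longrightarrow>
               norm (e (x + 2 * h) - 2 *\<^sub>R e (x + h) + e x) \<le> M * h\<^sup>2"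
    and ends: "e a = 0" "e b = 0" and s: "s \<in> {a..b}"
  shows "norm (e s) \<le> M * ((b - a) / 2)\<^sup>2"
proof -
  have "\<exists>p\<in>{a..b}. \<forall>s\<in>{a..b}. norm (e s) \<le> norm (e p)"
    by (rule continuous_attains_sup) (use ab cont in \<open>auto intro!: continuous_intros\<close>)
  then obtain p where p: "p \<in> {a..b}" and max: "\<And>s. s \<in> {a..b} \<Longrightarrow> norm (e s) \<le> norm (e p)" by blast
  define h where "h = min (p - a) (b - p)"
  have h: "0 \<le> h" "h \<le> (b - a) / 2" "a \<le> p - h" "p + h \<le> b" using p by (auto simp: h_def min_def field_simps)
  have one_zero: "e (p - h) = 0 \<or> e (p + h) = 0" using ends by (auto simp: h_def min_def)
  have "norm (e ((p - h) + 2 * h) - 2 *\<^sub>R e ((p - h) + h) + e (p - h)) \<le> M * h\<^sup>2"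
    by (rule sd) (use h in auto)
  then have D: "norm (e (p + h) - 2 *\<^sub>R e p + e (p - h)) \<le> M * h\<^sup>2" by (simp add: algebra_simps)
  have "2 *\<^sub>R e p = (e (p + h) + e (p - h)) - (e (p + h) - 2 *\<^sub>R e p + e (p - h))" by simp
  then have "2 * norm (e p) \<le> norm (e (p + h) + e (p - h)) + norm (e (p + h) - 2 *\<^sub>R e p + e (p - h))"
    by (metis norm_scaleR norm_triangle_ineq4 abs_numeral)
  also have "norm (e (p + h) + e (p - h)) \<le> norm (e p)"
    using one_zero max[of "p + h"] max[of "p - h"] h p by auto
  finally have "norm (e p) \<le> M * h\<^sup>2" using D by simp
  also have "\<dots> \<le> M * ((b - a) / 2)\<^sup>2" using h \<open>0 \<le> M\<close> by (intro mult_left_mono power_mono) auto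
  finally show ?thesis using max[OF s] by simp
qed

text \<open>Subtracting the linear interpolant does not change second differences, and the trapezoidal rule
  is the integral of the interpolant.\<close>

lemma trapezoid_error:
  fixes g :: "real \<Rightarrow> 'a::banach"
  assumes ab: "a \<le> b" and cont: "continuous_on {a..b} g" and "0 \<le> M"
    and sd: "\<And>x h. a \<le> x \<Longrightarrow> 0 \<le> h \<Longrightarrow> x + 2 * h \<le> b \<Longrightarrow>
               norm (g (x + 2 * h) - 2 *\<^sub>R g (x + h) + g x) \<le> M * h\<^sup>2"
  shows "norm (integral {a..b} g - ((b - a) / 2) *\<^sub>R (g a + g b)) \<le> M / 4 * (b - a) ^ 3"
proof (cases "a = b")
  case False
  then have "a < b" using ab by simp
  define c where "c = (1 / (b - a)) *\<^sub>R (g b - g a)"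
  have c: "(b - a) *\<^sub>R c = g b - g a" using \<open>a < b\<close> by (simp add: c_def)
  define e where "e s = g s - (g a + (s - a) *\<^sub>R c)" for s
  have e_cont: "continuous_on {a..b} e"
    unfolding e_def by (intro continuous_intros cont)
  have e_le: "norm (e s) \<le> M * ((b - a) / 2)\<^sup>2" if "s \<in> {a..b}" for s
  proof (rule norm_le_of_second_differences[OF ab e_cont \<open>0 \<le> M\<close> _ _ _ that])
    fix x h assume xh: "a \<le> x" "0 \<le> h" "x + 2 * h \<le> b"
    have "e (x + 2 * h) - 2 *\<^sub>R e (x + h) + e x = g (x + 2 * h) - 2 *\<^sub>R g (x + h) + g x"
      by (simp add: e_def algebra_simps scaleR_2 flip: scaleR_add_left)
    then show "norm (e (x + 2 * h) - 2 *\<^sub>R e (x + h) + e x) \<le> M * h\<^sup>2" using sd[OF xh] by simp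
  qed (use c in \<open>simp_all add: e_def\<close>)
  have "((\<lambda>s. g a + (s - a) *\<^sub>R c) has_integral
      (b *\<^sub>R g a + ((b - a)\<^sup>2 / 2) *\<^sub>R c - (a *\<^sub>R g a + ((a - a)\<^sup>2 / 2) *\<^sub>R c))) {a..b}"
    by (rule fundamental_theorem_of_calculus[OF ab]) (auto intro!: derivative_eq_intros)
  moreover have "b *\<^sub>R g a + ((b - a)\<^sup>2 / 2) *\<^sub>R c - (a *\<^sub>R g a + ((a - a)\<^sup>2 / 2) *\<^sub>R c)
      = ((b - a) / 2) *\<^sub>R (g a + g b)"
  proof -
    have "((b - a)\<^sup>2 / 2) *\<^sub>R c = ((b - a) / 2) *\<^sub>R (g b - g a)"
      unfolding c[symmetric] by (simp add: power2_eq_square)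
    then have "b *\<^sub>R g a + ((b - a)\<^sup>2 / 2) *\<^sub>R c - (a *\<^sub>R g a + ((a - a)\<^sup>2 / 2) *\<^sub>R c)
      = (b - a) *\<^sub>R g a + ((b - a) / 2) *\<^sub>R (g b - g a)" by (simp add: scaleR_diff_left)
    also have "(b - a) *\<^sub>R g a = ((b - a) / 2) *\<^sub>R (2 *\<^sub>R g a)" by simp
    also have "\<dots> + ((b - a) / 2) *\<^sub>R (g b - g a) = ((b - a) / 2) *\<^sub>R (2 *\<^sub>R g a + (g b - g a))"
      by (simp only: scaleR_add_right)
    also have "2 *\<^sub>R g a + (g b - g a) = g a + g b" by (simp add: scaleR_2)
    finally show ?thesis .
  qed
  moreover have "(g has_integral integral {a..b} g) {a..b}"
    using integrable_continuous_real[OF cont] by (rule integrable_integral)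
  ultimately have "(e has_integral (integral {a..b} g - ((b - a) / 2) *\<^sub>R (g a + g b))) {a..b}"
    unfolding e_def by (metis has_integral_diff)
  then have "norm (integral {a..b} g - ((b - a) / 2) *\<^sub>R (g a + g b))
      \<le> (M * ((b - a) / 2)\<^sup>2) * measure lborel (cbox a b)"
    by (intro has_integral_bound[of _ e]) (use e_le \<open>0 \<le> M\<close> in auto)
  then show ?thesis using ab by (simp add: power2_eq_square power3_eq_cube field_simps)
qed simp

lemma composite_trapezoid_error:
  fixes g :: "real \<Rightarrow> 'a::banach"
  assumes "continuous_on {0..real n * k} g" "0 \<le> k" "0 \<le> M"
    and "\<And>x h. 0 \<le> x \<Longrightarrow> 0 \<le> h \<Longrightarrow> x + 2 * h \<le> real n * k \<Longrightarrow>
               norm (g (x + 2 * h) - 2 *\<^sub>R g (x + h) + g x) \<le> M * h\<^sup>2"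
  shows "norm (integral {0..real n * k} g
           - (\<Sum>i<n. (k / 2) *\<^sub>R (g (real i * k) + g (real (Suc i) * k)))) \<le> real n * (M / 4 * k ^ 3)"
  using assms(1,4)
proof (induction n)
  case (Suc n)
  define t where "t = real n * k"
  have t: "real (Suc n) * k = t + k" "0 \<le> t" using \<open>0 \<le> k\<close> by (simp_all add: t_def algebra_simps)
  define Y where "Y = (\<Sum>i<n. (k / 2) *\<^sub>R (g (real i * k) + g (real (Suc i) * k)))"
  define Z where "Z = (k / 2) *\<^sub>R (g t + g (t + k))"
  have sum: "(\<Sum>i<Suc n. (k / 2) *\<^sub>R (g (real i * k) + g (real (Suc i) * k))) = Y + Z"
    by (simp add: Y_def Z_def t_def distrib_right add.commute)
  have "norm (integral {t..t + k} g - ((t + k - t) / 2) *\<^sub>R (g t + g (t + k))) \<le> M / 4 * (t + k - t) ^ 3"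
    by (rule trapezoid_error) (use Suc.prems t assms(2,3) in \<open>auto intro: continuous_on_subset\<close>)
  then have "norm (integral {t..t + k} g - Z) \<le> M / 4 * k ^ 3" by (simp add: Z_def)
  moreover have "norm (integral {0..t} g - Y) \<le> real n * (M / 4 * k ^ 3)"
    unfolding t_def Y_def
    by (rule Suc.IH) (use Suc.prems t \<open>0 \<le> k\<close> in \<open>auto simp: t_def intro: continuous_on_subset\<close>)
  moreover have "integral {0..t + k} g = integral {0..t} g + integral {t..t + k} g"
    by (rule Henstock_Kurzweil_Integration.integral_combine[symmetric])
      (use Suc.prems t \<open>0 \<le> k\<close> in \<open>auto intro!: integrable_continuous_real\<close>)
  ultimately have "norm (integral {0..t + k} g - (Y + Z)) \<le> real n * (M / 4 * k ^ 3) + M / 4 * k ^ 3"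
    by (metis (no_types, lifting) add_diff_add norm_triangle_mono)
  then show ?case unfolding sum t(1) by (simp add: algebra_simps)
qed simp

lemma trapezoid_sum_eq:
  fixes x :: "nat \<Rightarrow> 'a::real_vector"
  shows "(\<Sum>i<Suc m. (k / 2) *\<^sub>R (x i + x (Suc i)))
    = (k / 2) *\<^sub>R x 0 + k *\<^sub>R (\<Sum>i=1..m. x i) + (k / 2) *\<^sub>R x (Suc m)"
proof (induction m)
  case (Suc m)
  have half: "k *\<^sub>R y = (k / 2) *\<^sub>R y + (k / 2) *\<^sub>R y" for y :: 'a
    by (simp flip: scaleR_add_left)
  show ?case using Suc by (simp add: scaleR_add_right half[of "x (Suc m)"] ac_simps)
qed (simp add: scaleR_add_right)

text \<open>The quadrature rule of the time discretization, where \<open>g\<close> at the last node is replaced by its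
  value at the preceding node. For \<open>n = 1\<close> the middle sum is empty and both end terms sit at the origin.\<close>

lemma one_sided_trapezoid_error:
  fixes g :: "real \<Rightarrow> 'a::banach"
  assumes g: "C11_bound (real n * k) M g" and "0 \<le> k" "0 < n"
  shows "norm (integral {0..real n * k} g
           - ((k / 2) *\<^sub>R g 0 + k *\<^sub>R (\<Sum>i=1..n-1. g (real i * k)) + (k / 2) *\<^sub>R g (real (n - 1) * k)))
         \<le> (M / 4 * (real n * k) + M / 2) * k\<^sup>2"
proof -
  obtain m where n: "n = Suc m" using \<open>0 < n\<close> gr0_conv_Suc by blast
  define I where "I = integral {0..real n * k} g"
  define S where "S = (k / 2) *\<^sub>R g 0 + k *\<^sub>R (\<Sum>i=1..m. g (real i * k))"
  have "norm (I - (S + (k / 2) *\<^sub>R g (real n * k))) \<le> real n * (M / 4 * k ^ 3)"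
    using composite_trapezoid_error[OF C11_bound_imp_continuous[OF g] \<open>0 \<le> k\<close> C11_boundD(1,4)[OF g]]
      trapezoid_sum_eq[of k "\<lambda>i. g (real i * k)" m] by (simp add: n I_def S_def)
  moreover have "norm (g (real n * k) - g (real m * k)) \<le> M * k"
    using C11_boundD(3)[OF g, of "real m * k" k] \<open>0 \<le> k\<close> by (simp add: n algebra_simps)
  then have "norm ((k / 2) *\<^sub>R (g (real n * k) - g (real m * k))) \<le> (k / 2) * (M * k)"
    using \<open>0 \<le> k\<close> by (auto simp: n intro!: mult_left_mono)
  moreover have "I - (S + (k / 2) *\<^sub>R g (real m * k))
      = (I - (S + (k / 2) *\<^sub>R g (real n * k))) + (k / 2) *\<^sub>R (g (real n * k) - g (real m * k))"
    by (simp add: scaleR_diff_right)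
  ultimately have "norm (I - (S + (k / 2) *\<^sub>R g (real m * k)))
      \<le> real n * (M / 4 * k ^ 3) + (k / 2) * (M * k)"
    by (metis (no_types, lifting) norm_triangle_mono)
  also have "\<dots> = (M / 4 * (real n * k) + M / 2) * k\<^sup>2"
    by (simp add: power2_eq_square power3_eq_cube algebra_simps)
  finally show ?thesis by (simp add: n I_def S_def)
qed

section \<open>The discretized history operator\<close>

text \<open>The last quadrature node is \<open>n - 1\<close>, so only errors strictly before \<open>n\<close> enter; this is what makes the
  scheme explicit in the history term. Each of the three groups of weights is bounded separately
  by the full sum, which gives \<open>k / 2 + k + k / 2 = 2 * k\<close>.\<close>

lemma history_op_disc_lipschitz:
  fixes q :: "real \<times> real \<Rightarrow> 'a::banach \<Rightarrow>\<^sub>L 'a" and R :: "'a \<Rightarrow>\<^sub>L 'c::real_normed_vector"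
  assumes k: "0 \<le> k" and "0 \<le> B"
    and q: "\<And>i. i < n \<Longrightarrow> norm (q (real n * k, real i * k)) \<le> B"
  shows "norm (history_op_disc R q a k v n - history_op_disc R q a k w n)
    \<le> norm R * (2 * B * k * (\<Sum>i<n. norm (v i - w i)))"
proof (cases "n = 0")
  case False
  define d where "d i = v i - w i" for i
  define p where "p i = q (real n * k, real i * k)" for i
  define E where "E = (\<Sum>i<n. norm (d i))"
  have term_le: "norm (p i (d i)) \<le> B * norm (d i)" if "i < n" for i
    using norm_blinfun[of "p i" "d i"] mult_right_mono[OF q[OF that] norm_ge_zero[of "d i"]]
    by (simp add: p_def)
  have single: "norm (p i (d i)) \<le> B * E" if "i < n" for i
    using term_le[OF that] mult_left_mono[OF member_le_sum[of i "{..<n}" "\<lambda>i. norm (d i)"] \<open>0 \<le> B\<close>] that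
    by (simp add: E_def)
  have "norm (\<Sum>i=1..n-1. p i (d i)) \<le> (\<Sum>i=1..n-1. B * norm (d i))"
    by (rule sum_norm_le) (use term_le in auto)
  also have "\<dots> \<le> (\<Sum>i<n. B * norm (d i))"
    by (rule sum_mono2) (use \<open>0 \<le> B\<close> in auto)
  finally have middle: "norm (\<Sum>i=1..n-1. p i (d i)) \<le> B * E" by (simp add: E_def sum_distrib_left)
  define X where "X v = (k / 2) *\<^sub>R p 0 (v 0) + k *\<^sub>R (\<Sum>i=1..n-1. p i (v i)) + (k / 2) *\<^sub>R p (n - 1) (v (n - 1))" for v
  have X: "history_op_disc R q a k v n = R (X v + a)" for v
    using False by (simp add: history_op_disc_def X_def p_def)
  have "X v + a - (X w + a) = X d"
    by (simp add: X_def d_def blinfun.diff_right sum_subtractf scaleR_diff_right)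
  then have "history_op_disc R q a k v n - history_op_disc R q a k w n = R (X d)"
    unfolding X blinfun.diff_right[symmetric] by simp
  also have "norm \<dots> \<le> norm R * norm (X d)"
    by (rule norm_blinfun)
  also have "\<dots> \<le> norm R * ((k / 2) * (B * E) + k * (B * E) + (k / 2) * (B * E))"
    unfolding X_def using False k single[of 0] single[of "n - 1"] middle
    by (intro mult_left_mono norm_triangle_mono) (auto intro!: mult_left_mono)
  also have "\<dots> = norm R * (2 * B * k * E)" by simp
  finally show ?thesis by (simp add: E_def d_def)
qed (simp add: history_op_disc_def)

lemma history_op_consistency:
  fixes q :: "real \<times> real \<Rightarrow> 'a::banach \<Rightarrow>\<^sub>L 'a" and R :: "'a \<Rightarrow>\<^sub>L 'c::real_normed_vector"
  assumes q: "\<And>t. t \<in> {0..T} \<Longrightarrow> C11_bound T B (\<lambda>s. q (t, s))" and u: "C11_bound T U u"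
    and k: "0 \<le> k" "real n * k \<le> T"
  shows "norm (history_op R q a u (real n * k) - history_op_disc R q a k (\<lambda>i. u (real i * k)) n)
    \<le> norm R * (B * U * T + 2 * B * U) * k\<^sup>2"
proof -
  define t where "t = real n * k"
  have t: "t \<in> {0..T}" using k by (simp add: t_def)
  define g where "g s = q (t, s) (u s)" for s
  have g: "C11_bound t (4 * B * U) g"
    unfolding g_def using t by (intro C11_bound_mono[OF C11_bound_blinfun_apply[OF q u]]) auto
  have BU: "0 \<le> B * U" using C11_boundD(1)[OF g] by simp
  show ?thesis
  proof (cases "n = 0")
    case False
    define D where "D = (k / 2) *\<^sub>R g 0 + k *\<^sub>R (\<Sum>i=1..n-1. g (real i * k)) + (k / 2) *\<^sub>R g (real (n - 1) * k)"
    have "norm (integral {0..t} g - D) \<le> ((4 * B * U) / 4 * t + (4 * B * U) / 2) * k\<^sup>2"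
      unfolding D_def t_def
      by (rule one_sided_trapezoid_error) (use g k False in \<open>auto simp: t_def\<close>)
    also have "\<dots> \<le> (B * U * T + 2 * B * U) * k\<^sup>2"
      using mult_left_mono[of t T "B * U"] t BU by (intro mult_right_mono) auto
    finally have quad: "norm (integral {0..t} g - D) \<le> (B * U * T + 2 * B * U) * k\<^sup>2" .
    have "history_op R q a u (real n * k) - history_op_disc R q a k (\<lambda>i. u (real i * k)) n
        = R (integral {0..t} g + a) - R (D + a)"
      using False by (simp add: history_op_def history_op_disc_def g_def[abs_def] D_def t_def)
    also have "\<dots> = R (integral {0..t} g - D)" by (simp add: blinfun.diff_right blinfun.add_right)
    also have "norm \<dots> \<le> norm R * norm (integral {0..t} g - D)" by (rule norm_blinfun)
    also have "\<dots> \<le> norm R * ((B * U * T + 2 * B * U) * k\<^sup>2)" using quad by (intro mult_left_mono) auto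
    finally show ?thesis by (simp add: mult.assoc)
  qed (use BU t in \<open>simp add: history_op_def history_op_disc_def\<close>)
qed

section \<open>Stability and the error estimate\<close>

text \<open>Each of the two inequalities is tested with the solution of the other one. In the sum the loads
  cancel, and the terms left over match the hypotheses on \<open>A\<close>, \<open>\<phi>\<close> and \<open>j\<close>.\<close>

lemma solves_vhi_stability:
  fixes K :: "'x::banach set" and \<gamma>\<^sub>j :: "'x \<Rightarrow>\<^sub>L 'z::banach"
    and \<phi> :: "'y::real_normed_vector \<Rightarrow> 'x \<Rightarrow> 'x \<Rightarrow> real"
  assumes sol: "solves_vhi K A \<phi> j \<gamma>\<^sub>j y1 f w1" "solves_vhi K A \<phi> j \<gamma>\<^sub>j y2 f w2"
    and \<gamma>: "\<And>v. norm (blinfun_apply \<gamma>\<^sub>j v) \<le> c\<^sub>j * norm v"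
    and A: "\<And>v1 v2. blinfun_apply (A v1 - A v2) (v1 - v2) \<ge> m\<^sub>A * (norm (v1 - v2))\<^sup>2"
    and \<phi>: "\<And>y1 y2 u1 u2 v1 v2. \<lbrakk>u1 \<in> K; u2 \<in> K; v1 \<in> K; v2 \<in> K\<rbrakk> \<Longrightarrow>
         \<phi> y1 u1 v2 - \<phi> y1 u1 v1 + \<phi> y2 u2 v1 - \<phi> y2 u2 v2
           \<le> \<alpha>\<^sub>\<phi> * norm (u1 - u2) * norm (v1 - v2) + \<beta>\<^sub>\<phi> * norm (y1 - y2) * norm (v1 - v2)"
    and j: "0 \<le> \<alpha>\<^sub>j" "\<And>z1 z2. clarke_deriv j z1 (z2 - z1) + clarke_deriv j z2 (z1 - z2)
                  \<le> \<alpha>\<^sub>j * (norm (z1 - z2))\<^sup>2"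
    and "0 \<le> \<beta>\<^sub>\<phi>"
  shows "(m\<^sub>A - (\<alpha>\<^sub>\<phi> + \<alpha>\<^sub>j * c\<^sub>j\<^sup>2)) * norm (w1 - w2) \<le> \<beta>\<^sub>\<phi> * norm (y1 - y2)"
proof (cases "w1 = w2")
  case False
  have K: "w1 \<in> K" "w2 \<in> K" using sol by (simp_all add: solves_vhi_def)
  have "blinfun_apply (A w1) (w2 - w1) + \<phi> y1 w1 w2 - \<phi> y1 w1 w1
      + clarke_deriv j (\<gamma>\<^sub>j w1) (\<gamma>\<^sub>j w2 - \<gamma>\<^sub>j w1) \<ge> f (w2 - w1)"
    using sol(1) K by (simp add: solves_vhi_def)
  moreover have "blinfun_apply (A w2) (w1 - w2) + \<phi> y2 w2 w1 - \<phi> y2 w2 w2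
      + clarke_deriv j (\<gamma>\<^sub>j w2) (\<gamma>\<^sub>j w1 - \<gamma>\<^sub>j w2) \<ge> f (w1 - w2)"
    using sol(2) K by (simp add: solves_vhi_def)
  moreover have "f (w1 - w2) + f (w2 - w1) = 0" by (simp add: blinfun.diff_right)
  moreover have "blinfun_apply (A w1) (w2 - w1) + blinfun_apply (A w2) (w1 - w2)
      = - blinfun_apply (A w1 - A w2) (w1 - w2)"
    by (simp add: blinfun.diff_left blinfun.diff_right)
  moreover have "clarke_deriv j (\<gamma>\<^sub>j w1) (\<gamma>\<^sub>j w2 - \<gamma>\<^sub>j w1) + clarke_deriv j (\<gamma>\<^sub>j w2) (\<gamma>\<^sub>j w1 - \<gamma>\<^sub>j w2)
      \<le> \<alpha>\<^sub>j * c\<^sub>j\<^sup>2 * (norm (w1 - w2))\<^sup>2"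
  proof -
    have "(norm (\<gamma>\<^sub>j w1 - \<gamma>\<^sub>j w2))\<^sup>2 \<le> (c\<^sub>j * norm (w1 - w2))\<^sup>2"
      using \<gamma>[of "w1 - w2"] by (intro power_mono) (auto simp: blinfun.diff_right)
    from mult_left_mono[OF this j(1)] show ?thesis
      using j(2)[of "\<gamma>\<^sub>j w1" "\<gamma>\<^sub>j w2"] by (simp add: power_mult_distrib mult.assoc)
  qed
  moreover note A[of w1 w2] \<phi>[OF K K, of y1 y2]
  ultimately have "m\<^sub>A * (norm (w1 - w2))\<^sup>2 \<le> \<alpha>\<^sub>\<phi> * norm (w1 - w2) * norm (w1 - w2)
      + \<beta>\<^sub>\<phi> * norm (y1 - y2) * norm (w1 - w2) + \<alpha>\<^sub>j * c\<^sub>j\<^sup>2 * (norm (w1 - w2))\<^sup>2"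
    by linarith
  then have "((m\<^sub>A - (\<alpha>\<^sub>\<phi> + \<alpha>\<^sub>j * c\<^sub>j\<^sup>2)) * norm (w1 - w2)) * norm (w1 - w2)
      \<le> (\<beta>\<^sub>\<phi> * norm (y1 - y2)) * norm (w1 - w2)"
    by (simp add: power2_eq_square algebra_simps)
  then show ?thesis using False by (simp add: mult_le_cancel_right)
qed (use \<open>0 \<le> \<beta>\<^sub>\<phi>\<close> in simp)

text \<open>The sequence \<open>a * (1 + b) ^ n\<close> satisfies the recursion with equality and hence dominates.\<close>

lemma discrete_gronwall:
  fixes e :: "nat \<Rightarrow> real"
  assumes "0 \<le> a" "0 \<le> b" and e: "\<And>n. n \<le> N \<Longrightarrow> e n \<le> a + b * (\<Sum>i<n. e i)" and "n \<le> N"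
  shows "e n \<le> a * exp (real n * b)"
proof -
  have geometric: "a + b * (\<Sum>i<n. a * (1 + b) ^ i) = a * (1 + b) ^ n" for n
    by (induction n) (simp_all add: algebra_simps)
  have "e n \<le> a * (1 + b) ^ n"
    using \<open>n \<le> N\<close>
  proof (induction n rule: less_induct)
    case (less n)
    have "e n \<le> a + b * (\<Sum>i<n. e i)" by (rule e[OF less.prems])
    also have "\<dots> \<le> a + b * (\<Sum>i<n. a * (1 + b) ^ i)"
      using less \<open>0 \<le> b\<close> by (intro add_left_mono mult_left_mono sum_mono) auto
    finally show ?case by (simp only: geometric)
  qed
  also have "\<dots> \<le> a * exp b ^ n"
    using assms(1,2) exp_ge_add_one_self[of b] by (intro mult_left_mono power_mono) auto
  finally show ?thesis by (simp add: exp_of_nat_mult)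
qed

theorem theorem15:
  fixes K :: "'x::banach set"
    and \<gamma>\<^sub>j :: "'x \<Rightarrow>\<^sub>L 'z::banach"
    and A :: "'x \<Rightarrow> 'x \<Rightarrow>\<^sub>L real"
    and \<phi> :: "'y::real_normed_vector \<Rightarrow> 'x \<Rightarrow> 'x \<Rightarrow> real"
    and j :: "'z \<Rightarrow> real"
    and f :: "real \<Rightarrow> 'x \<Rightarrow>\<^sub>L real"
    and R :: "'x \<Rightarrow>\<^sub>L 'y"
    and q :: "real \<times> real \<Rightarrow> 'x \<Rightarrow>\<^sub>L 'x"
    and a\<^sub>S :: 'x
    and u :: "real \<Rightarrow> 'x"
    and c\<^sub>j L\<^sub>A m\<^sub>A \<alpha>\<^sub>\<phi> \<beta>\<^sub>\<phi> c\<^sub>0 c\<^sub>1 \<alpha>\<^sub>j T :: real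
  assumes reflexive: "reflexive_space TYPE('x)"
    and K: "closed K" "convex K" "0 \<in> K"
    and \<gamma>: "c\<^sub>j > 0" "\<And>v. norm (blinfun_apply \<gamma>\<^sub>j v) \<le> c\<^sub>j * norm v"
    and A_lipschitz: "L\<^sub>A > 0" "L\<^sub>A-lipschitz_on UNIV A"
    and A_monotone: "m\<^sub>A > 0"
      "\<And>v1 v2. blinfun_apply (A v1 - A v2) (v1 - v2) \<ge> m\<^sub>A * (norm (v1 - v2))\<^sup>2"
    and \<phi>_convex: "\<And>y w. w \<in> K \<Longrightarrow> convex_on K (\<phi> y w)"
    and \<phi>_lsc: "\<And>y w. w \<in> K \<Longrightarrow> lower_semicontinuous_on K (\<phi> y w)"
    and \<phi>_bound: "\<alpha>\<^sub>\<phi> > 0" "\<beta>\<^sub>\<phi> > 0"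
      "\<And>y1 y2 u1 u2 v1 v2. \<lbrakk>u1 \<in> K; u2 \<in> K; v1 \<in> K; v2 \<in> K\<rbrakk> \<Longrightarrow>
         \<phi> y1 u1 v2 - \<phi> y1 u1 v1 + \<phi> y2 u2 v1 - \<phi> y2 u2 v2
           \<le> \<alpha>\<^sub>\<phi> * norm (u1 - u2) * norm (v1 - v2) + \<beta>\<^sub>\<phi> * norm (y1 - y2) * norm (v1 - v2)"
    and j_lipschitz: "locally_lipschitz j"
    and j_growth: "c\<^sub>0 \<ge> 0" "c\<^sub>1 \<ge> 0"
      "\<And>z \<xi>. \<xi> \<in> clarke_subdiff j z \<Longrightarrow> norm \<xi> \<le> c\<^sub>0 + c\<^sub>1 * norm z"
    and j_relaxed: "\<alpha>\<^sub>j > 0"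
      "\<And>z1 z2. clarke_deriv j z1 (z2 - z1) + clarke_deriv j z2 (z1 - z2)
                  \<le> \<alpha>\<^sub>j * (norm (z1 - z2))\<^sup>2"
    and f_cont: "continuous_on {0..} f"
    and q_cont: "continuous_on ({0..} \<times> {0..}) q"
    and small: "\<alpha>\<^sub>\<phi> + \<alpha>\<^sub>j * c\<^sub>j\<^sup>2 < m\<^sub>A"
    and q_C2: "C2_on ({0..} \<times> {0..}) q"
    and u_solution: "continuous_solution K A \<phi> j \<gamma>\<^sub>j f R q a\<^sub>S u"
    and u_regular: "u \<in> Sobolev_inf_loc 2"
    and T: "T > 0"
  shows "\<exists>C\<^sub>4>0. \<forall>N>0. \<forall>w. discrete_solution K A \<phi> j \<gamma>\<^sub>j f R q a\<^sub>S (T / real N) N w \<longrightarrow>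
           (MAX n\<in>{..N}. norm (u (real n * (T / real N)) - w n)) \<le> C\<^sub>4 * (T / real N)\<^sup>2"
proof -
  have u_cont: "continuous_on {0..} u"
    and u_vhi: "\<And>t. 0 \<le> t \<Longrightarrow> solves_vhi K A \<phi> j \<gamma>\<^sub>j (history_op R q a\<^sub>S u t) (f t) (u t)"
    using u_solution by (auto simp: continuous_solution_def)
  obtain B where q: "\<And>t. t \<in> {0..T} \<Longrightarrow> C11_bound T B (\<lambda>s. q (t, s))"
    using C2_kernel_imp_C11_bound[OF q_C2] by blast
  obtain U where u: "C11_bound T U u"
    using Sobolev_inf_loc_2_imp_C11_bound[OF u_regular u_cont T] by blast
  have B: "0 \<le> B" using C11_boundD(1)[OF q[of 0]] T by simp
  have U: "0 \<le> U" by (rule C11_boundD(1)[OF u])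
  define C where "C = norm R * (B * U * T + 2 * B * U)"
  have C: "0 \<le> C" using B U T by (simp add: C_def)
  define m where "m = m\<^sub>A - (\<alpha>\<^sub>\<phi> + \<alpha>\<^sub>j * c\<^sub>j\<^sup>2)"
  have m: "0 < m" using small by (simp add: m_def)
  define c where "c = \<beta>\<^sub>\<phi> / m"
  have c: "0 \<le> c" using m \<phi>_bound(2) by (simp add: c_def)
  define G where "G = 2 * c * norm R * B"
  have G: "0 \<le> G" using c B by (simp add: G_def)
  \<comment> \<open>The summand 1 only ensures that the constant is positive.\<close>
  show ?thesis
  proof (intro exI[of _ "c * C * exp (G * T) + 1"] conjI allI impI)
    show "0 < c * C * exp (G * T) + 1" using c C by (simp add: add_nonneg_pos)
    fix N :: nat and w
    assume "0 < N" and w: "discrete_solution K A \<phi> j \<gamma>\<^sub>j f R q a\<^sub>S (T / real N) N w"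
    define k where "k = T / real N"
    have k: "0 \<le> k" "real N * k = T" using T \<open>0 < N\<close> by (simp_all add: k_def)
    have grid: "real n * k \<in> {0..T}" if "n \<le> N" for n
      using that k mult_right_mono[of "real n" "real N" k] by simp
    define e where "e n = norm (u (real n * k) - w n)" for n
    have recursion: "e n \<le> c * C * k\<^sup>2 + (G * k) * (\<Sum>i<n. e i)" if n: "n \<le> N" for n
    proof -
      define y where "y = history_op R q a\<^sub>S u (real n * k)"
      \<comment> \<open>The history term is compared in two steps, through the discrete operator applied to the exact solution.\<close>
      define yd where "yd = history_op_disc R q a\<^sub>S k (\<lambda>i. u (real i * k)) n"
      define yk where "yk = history_op_disc R q a\<^sub>S k w n"
      have stable: "m * e n \<le> \<beta>\<^sub>\<phi> * norm (y - yk)"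
        unfolding m_def e_def
      proof (rule solves_vhi_stability[OF _ _ \<gamma>(2) A_monotone(2) \<phi>_bound(3)
            less_imp_le[OF j_relaxed(1)] j_relaxed(2) less_imp_le[OF \<phi>_bound(2)]])
        show "solves_vhi K A \<phi> j \<gamma>\<^sub>j y (f (real n * k)) (u (real n * k))"
          unfolding y_def using u_vhi grid[OF n] by simp
        show "solves_vhi K A \<phi> j \<gamma>\<^sub>j yk (f (real n * k)) (w n)"
          using w n unfolding yk_def discrete_solution_def k_def by blast
      qed
      have "norm (y - yk) \<le> norm (y - yd) + norm (yd - yk)"
        by (rule order_trans[OF _ norm_triangle_ineq]) simp
      moreover have "norm (y - yd) \<le> C * k\<^sup>2"
        unfolding y_def yd_def C_def by (rule history_op_consistency[OF q u]) (use k grid[OF n] in auto)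
      moreover have "norm (yd - yk) \<le> norm R * (2 * B * k * (\<Sum>i<n. e i))"
        unfolding yd_def yk_def e_def
      proof (rule history_op_disc_lipschitz[OF k(1) B])
        show "norm (q (real n * k, real i * k)) \<le> B" if "i < n" for i
          using C11_boundD(2)[OF q[OF grid[OF n]], of "real i * k"] grid[of i] that n by simp
      qed
      ultimately have "norm (y - yk) \<le> C * k\<^sup>2 + norm R * (2 * B * k * (\<Sum>i<n. e i))" by linarith
      then have "m * e n \<le> \<beta>\<^sub>\<phi> * (C * k\<^sup>2 + norm R * (2 * B * k * (\<Sum>i<n. e i)))"
        by (rule order_trans[OF stable mult_left_mono[OF _ less_imp_le[OF \<phi>_bound(2)]]])
      then have "e n \<le> c * (C * k\<^sup>2 + norm R * (2 * B * k * (\<Sum>i<n. e i)))"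
        using m by (simp add: c_def field_simps)
      also have "\<dots> = c * C * k\<^sup>2 + (G * k) * (\<Sum>i<n. e i)" by (simp add: G_def algebra_simps)
      finally show ?thesis .
    qed
    have "e n \<le> (c * C * exp (G * T) + 1) * k\<^sup>2" if n: "n \<le> N" for n
    proof -
      have "e n \<le> c * C * k\<^sup>2 * exp (real n * (G * k))"
        by (rule discrete_gronwall[OF _ _ recursion n]) (use c C G k in auto)
      also have "\<dots> \<le> c * C * k\<^sup>2 * exp (G * T)"
        using grid[OF n] mult_left_mono[of "real n * k" T G] G c C
        by (intro mult_left_mono) (auto simp: algebra_simps)
      also have "\<dots> \<le> (c * C * exp (G * T) + 1) * k\<^sup>2" by (simp add: algebra_simps)
      finally show ?thesis .
    qed
    then show "(MAX n\<in>{..N}. norm (u (real n * (T / real N)) - w n))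
        \<le> (c * C * exp (G * T) + 1) * (T / real N)\<^sup>2"
      by (simp add: e_def k_def)
  qed
qed

end
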